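(* Let $k\ge1$ be an integer and let $0<\alpha<\beta<1$. Then, with $\mathbf u$ ranging over the vectors in $\mathbb R^k$ with $M_2(\mathbf u)=1$, $\mathrm{ARE}_{p,2,\mathbf u}=\mathrm{ARE}_{p,2,\mathbf u}(\alpha,\beta)$ is Schur$^2$-convex in $\mathbf u$ for each $p\in[2,\infty]$ and Schur$^2$-concave in $\mathbf u$ for each $p\in[-\infty,2]$. Therefore, for each $p\in[-\infty,\infty]$, the value of $\mathrm{ARE}_{p,2,\mathbf u}$ for any vector $\mathbf u\in\mathbb R^k$ with $M_2(\mathbf u)=1$ lies between the value of $\mathrm{ARE}_{p,2,\mathbf u}$ for $\mathbf u=\mathbf 1:=(1,\dots,1)\in\mathbb R^k$ and that for $\mathbf u=\sqrt k\,\mathbf e_1$, where $\mathbf e_1:=(1,0,\dots,0)\in\mathbb R^k$.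
   Context: $p$-means: for real $p\ne0$ and $\mathbf x\in\mathbb R^k$, $M_p(\mathbf x):=\big(\frac1k\sum_{j=1}^k|x_j|^p\big)^{1/p}$, where for $p<0$ the conventions $0^p:=\infty$ and $\infty^{1/p}:=0$ are used (so $M_p(\mathbf x)=0$ if $p<0$ and some $x_j=0$); also $M_{-\infty}(\mathbf x)=\min_j|x_j|$, $M_0(\mathbf x)=\prod_{j=1}^k|x_j|^{1/k}$, $M_\infty(\mathbf x)=\max_j|x_j|$. Let $\mathbf Z$ be a standard normal random vector in $\mathbb R^k$ (zero mean, identity covariance). For $p\in[-\infty,\infty]$ let $c_p=c_{p,\alpha}$ be the unique positive root $c$ of $\mathsf P(M_p(\mathbf Z)>c)=\alpha$. For $\mathbf u\in\mathbb R^k$ with $M_2(\mathbf u)=1$, let $\mathbf s_p=\mathbf s_{p;\alpha,\beta,\mathbf u}$ be the vector $\mathbf s$ in the direction of $\mathbf u$ (i.e. $\mathbf s=t\mathbf u$ with $t>0$) such that $\mathsf P(M_p(\mathbf Z+\mathbf s)>c_p)=\beta$, provided such a vector exists; if it exists, it is unique. It exists for all $p\in[0,\infty]$ and all $\mathbf u$; in particular $\mathbf s_2$ always exists. Define (the asymptotic relative efficiency of the $p$-mean test relative to the $2$-mean test in direction $\mathbf u$) $$\mathrm{ARE}_{p,2,\mathbf u}(\alpha,\beta):=\frac{\|\mathbf s_2\|^2}{\|\mathbf s_p\|^2}$$ if $\mathbf s_p$ exists, and $\mathrm{ARE}_{p,2,\mathbf u}(\alpha,\beta):=0$ otherwise;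 $\|\cdot\|$ is the Euclidean norm. Majorization: for $\mathbf a,\mathbf b\in\mathbb R^k$, $\mathbf a\succeq\mathbf b$ means $\sum_i a_i=\sum_i b_i$ and $a_{[1]}+\dots+a_{[j]}\ge b_{[1]}+\dots+b_{[j]}$ for all $j\in\{1,\dots,k\}$, where $a_{[1]}\ge\dots\ge a_{[k]}$ are the numbers $a_1,\dots,a_k$ in nonincreasing order. Let $\mathbf x^2:=(x_1^2,\dots,x_k^2)$. A function $f(\mathbf u)$ is Schur$^2$-concave (respectively Schur$^2$-convex) in $\mathbf u$ if $f(\mathbf u)\ge f(\mathbf v)$ (respectively $f(\mathbf u)\le f(\mathbf v)$) for all $\mathbf u,\mathbf v$ in its domain with $\mathbf u^2\preceq\mathbf v^2$. *)

theory Defs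
  imports "HOL-Probability.Probability"
begin

text \<open>
  In the branch for finite nonzero \<open>p\<close>, the conventions \<open>0\<^sup>p = \<infinity>\<close> and
  \<open>\<infinity>\<^sup>1\<^sup>/\<^sup>p = 0\<close> for \<open>p < 0\<close> have to be spelled out, because
  \<open>0 powr p = 0\<close> for every real \<open>p\<close>.
\<close>

definition pmean :: "ereal \<Rightarrow> real ^ 'n \<Rightarrow> real" where
  "pmean p x =
    (if p = - \<infinity> then Min (range (\<lambda>j. \<bar>x $ j\<bar>))
     else if p = \<infinity> then Max (range (\<lambda>j. \<bar>x $ j\<bar>))
     else if p = 0 then (\<Prod>j\<in>UNIV. \<bar>x $ j\<bar> powr (1 / real CARD('n)))
     else if p < 0 \<and> (\<exists>j. x $ j = 0) then 0
     else ((1 / real CARD('n)) * (\<Sum>j\<in>UNIV. \<bar>x $ j\<bar> powr real_of_ereal p))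
            powr (1 / real_of_ereal p))"

definition std_normal_vec :: "(real ^ 'n) measure" where
  "std_normal_vec = density lborel (\<lambda>z. ennreal (\<Prod>j\<in>UNIV. std_normal_density (z $ j)))"

text \<open>
  The dimension appears in \<open>crit_val\<close> only through the index type, hence the
  \<open>itself\<close> argument.
\<close>

definition crit_val :: "'n::finite itself \<Rightarrow> ereal \<Rightarrow> real \<Rightarrow> real" where
  "crit_val _ p \<alpha> =
    (THE c. c > 0 \<and> measure (std_normal_vec :: (real ^ 'n) measure) {z. pmean p z > c} = \<alpha>)"

definition is_shift :: "ereal \<Rightarrow> real \<Rightarrow> real \<Rightarrow> real ^ 'n \<Rightarrow> real ^ 'n \<Rightarrow> bool" where
  "is_shift p \<alpha> \<beta> u s \<longleftrightarrow>
    (\<exists>t>0. s = t *\<^sub>R u) \<and>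
    measure std_normal_vec {z. pmean p (z + s) > crit_val TYPE('n) p \<alpha>} = \<beta>"

definition shift :: "ereal \<Rightarrow> real \<Rightarrow> real \<Rightarrow> real ^ 'n \<Rightarrow> real ^ 'n" where
  "shift p \<alpha> \<beta> u = (THE s. is_shift p \<alpha> \<beta> u s)"

definition ARE :: "ereal \<Rightarrow> real \<Rightarrow> real \<Rightarrow> real ^ 'n \<Rightarrow> real" where
  "ARE p \<alpha> \<beta> u =
    (if \<exists>s. is_shift p \<alpha> \<beta> u s
     then (norm (shift 2 \<alpha> \<beta> u))\<^sup>2 / (norm (shift p \<alpha> \<beta> u))\<^sup>2
     else 0)"

definition decreasing_list :: "real ^ 'n \<Rightarrow> real list" where
  "decreasing_list a =
    rev (sorted_list_of_multiset (image_mset (\<lambda>i. a $ i) (mset_set UNIV)))"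

definition majorizes :: "real ^ 'n \<Rightarrow> real ^ 'n \<Rightarrow> bool" where
  "majorizes a b \<longleftrightarrow>
    (\<Sum>i\<in>UNIV. a $ i) = (\<Sum>i\<in>UNIV. b $ i) \<and>
    (\<forall>j\<in>{1..CARD('n)}.
      sum_list (take j (decreasing_list a)) \<ge> sum_list (take j (decreasing_list b)))"

definition sq_vec :: "real ^ 'n \<Rightarrow> real ^ 'n" where
  "sq_vec x = (\<chi> i. (x $ i)\<^sup>2)"

definition schur_sq_concave_on :: "(real ^ 'n) set \<Rightarrow> (real ^ 'n \<Rightarrow> real) \<Rightarrow> bool" where
  "schur_sq_concave_on D f \<longleftrightarrow>
    (\<forall>u\<in>D. \<forall>v\<in>D. majorizes (sq_vec v) (sq_vec u) \<longrightarrow> f u \<ge> f v)"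

definition schur_sq_convex_on :: "(real ^ 'n) set \<Rightarrow> (real ^ 'n \<Rightarrow> real) \<Rightarrow> bool" where
  "schur_sq_convex_on D f \<longleftrightarrow>
    (\<forall>u\<in>D. \<forall>v\<in>D. majorizes (sq_vec v) (sq_vec u) \<longrightarrow> f u \<le> f v)"

end

theory Submission
  imports Defs "HOL-Combinatorics.Permutations"
begin

text \<open>
  Write the power of the \<open>p\<close>-mean test at the shift \<open>s\<close> as the integral of the indicator of
  \<open>{x. pmean p x > c}\<close> against the Gaussian density centred at \<open>s\<close>.  All comparisons of powers come
  from one reflection argument: if an isometry \<open>T\<close> exchanges two kernels \<open>K\<close> and \<open>L\<close>, then
  \<open>2 (\<integral> f K - \<integral> f L) = \<integral> (f - f \<circ> T) (K - L)\<close>, so it suffices that the two factors on the right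
  have the same sign pointwise.

  With \<open>T\<close> a reflection of one coordinate this shows that the power increases along rays, so that
  shifts are unique.  With \<open>T\<close> a reflection of a coordinate plane, and with the
  kernels averaged over the rotations by multiples of a right angle, it shows that the power inherits
  the monotonicity of \<open>pmean p\<close> under transfers of squared mass between two coordinates.  Chains of such
  transfers generate majorization, and \<open>pmean p\<close> is monotone under them by the convexity or concavity
  of \<open>x \<mapsto> x powr (p / 2)\<close>.  Finally, a larger power in the direction \<open>u\<close> means a shorter shift \<open>s\<^sub>p\<close>, while
  the shift \<open>s\<^sub>2\<close> has the same length in all directions, since \<open>2\<close> lies in both ranges of \<open>p\<close>.
\<close>

subsection \<open>Reflections and the Gaussian measure of shifted sets\<close>

text \<open>
  The library has \<open>measure_linear_image\<close> only for vectors indexed by a well-ordered type.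
  Here the image measure is compared with \<open>lborel\<close> by the uniqueness argument for Haar measure,
  with the unit ball as reference set.
\<close>

lemma distr_lborel_orthogonal:
  fixes T :: "'a::euclidean_space \<Rightarrow> 'a"
  assumes T: "orthogonal_transformation T"
  shows "distr lborel borel T = lborel"
proof (rule measure_eqI)
  have lin: "linear T" and bij: "bij T"
    using T orthogonal_transformation_linear orthogonal_transformation_bij by auto
  have meas[measurable]: "T \<in> borel_measurable borel"
    using lin by (intro borel_measurable_continuous_onI linear_continuous_on)
      (simp add: linear_linear)
  fix A assume "A \<in> sets (distr lborel borel T)"
  then have A[measurable]: "A \<in> sets borel" by simp
  define B where "B = ball (0::'a) 1"
  have B[measurable]: "B \<in> sets borel" by (simp add: B_def)
  have shift: "(\<integral>\<^sup>+x. f (c + x) \<partial>lborel) = (\<integral>\<^sup>+x. f x \<partial>lborel)"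
    if [measurable]: "f \<in> borel_measurable borel" for f :: "'a \<Rightarrow> ennreal" and c
  proof -
    have "(\<integral>\<^sup>+x. f x \<partial>lborel) = (\<integral>\<^sup>+x. f x \<partial>distr lborel borel ((+) c))"
      by (simp add: lborel_distr_plus)
    then show ?thesis by (simp add: nn_integral_distr)
  qed
  have Tinv: "T (inv T y) = y" for y
    using bij by (simp add: bij_is_surj surj_f_inv_f)
  \<comment> \<open>This is where the isometry enters: \<open>y - T x\<close> lies in the unit ball
    exactly when \<open>x\<close> lies in the unit ball about \<open>inv T y\<close>.\<close>
  have ball: "(\<integral>\<^sup>+x. indicator B (y - T x) \<partial>lborel) = emeasure lborel B" for y
  proof -
    have "norm (y - T x) = norm (inv T y - x)" for x
      using orthogonal_transformation_norm[OF T, of "inv T y - x"] lin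
      by (simp add: linear_diff Tinv)
    then have "(\<integral>\<^sup>+x. indicator B (y - T x) \<partial>lborel) = (\<integral>\<^sup>+x. indicator (ball (inv T y) 1) x \<partial>lborel)"
      by (intro nn_integral_cong) (auto simp: B_def dist_norm norm_minus_commute split: split_indicator)
    also have "\<dots> = emeasure lborel B"
      by (simp add: B_def emeasure_ball)
    finally show ?thesis .
  qed
  \<comment> \<open>One double integral is evaluated in two ways. Translating \<open>x\<close> by
    \<open>inv T y\<close> turns \<open>T x\<close> into \<open>y + T x\<close>; after Fubini,
    translating \<open>y\<close> by \<open>- T x\<close> moves the translation from \<open>A\<close>
    onto the ball, whose measure does not depend on its centre.\<close>
  have "emeasure (distr lborel borel T) A * emeasure lborel B =
      (\<integral>\<^sup>+y. indicator B y * (\<integral>\<^sup>+x. indicator A (T x) \<partial>lborel) \<partial>lborel)"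
    using nn_integral_distr[of T lborel borel "indicator A"]
    by (simp add: nn_integral_multc mult.commute)
  also have "\<dots> = (\<integral>\<^sup>+y. indicator B y * (\<integral>\<^sup>+x. indicator A (y + T x) \<partial>lborel) \<partial>lborel)"
    using shift[of "\<lambda>x. indicator A (T x)" "inv T _"] lin by (simp add: linear_add Tinv)
  also have "\<dots> = (\<integral>\<^sup>+y. (\<integral>\<^sup>+x. indicator B y * indicator A (y + T x) \<partial>lborel) \<partial>lborel)"
    by (simp add: nn_integral_cmult)
  also have "\<dots> = (\<integral>\<^sup>+x. (\<integral>\<^sup>+y. indicator B y * indicator A (y + T x) \<partial>lborel) \<partial>lborel)"
    by (rule lborel_pair.Fubini') measurable
  also have "\<dots> = (\<integral>\<^sup>+x. (\<integral>\<^sup>+y. indicator B (y - T x) * indicator A y \<partial>lborel) \<partial>lborel)"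
  proof (rule nn_integral_cong)
    fix x
    show "(\<integral>\<^sup>+y. indicator B y * indicator A (y + T x) \<partial>lborel) =
        (\<integral>\<^sup>+y. indicator B (y - T x) * indicator A y \<partial>(lborel :: 'a measure))"
      using shift[of "\<lambda>y. indicator B y * indicator A (y + T x)" "- T x"]
      by (simp add: algebra_simps)
  qed
  also have "\<dots> = (\<integral>\<^sup>+y. (\<integral>\<^sup>+x. indicator B (y - T x) * indicator A y \<partial>lborel) \<partial>lborel)"
    by (rule lborel_pair.Fubini') measurable
  also have "\<dots> = (\<integral>\<^sup>+y. emeasure lborel B * indicator A y \<partial>lborel)"
    by (simp add: nn_integral_multc ball)
  also have "\<dots> = emeasure lborel A * emeasure lborel B"
    by (subst nn_integral_cmult) (simp_all add: mult.commute)
  finally have "emeasure (distr lborel borel T) A * emeasure lborel B = emeasure lborel A * emeasure lborel B" .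
  moreover have "emeasure lborel B \<noteq> 0" "emeasure lborel B \<noteq> \<infinity>"
    using emeasure_lborel_ball_finite[of "0::'a" 1]
      unit_ball_vol_pos[of "real DIM('a)", THEN less_imp_neq, symmetric]
    by (auto simp: B_def emeasure_ball)
  ultimately show "emeasure (distr lborel borel T) A = emeasure lborel A"
    by (metis ennreal_mult_cancel_left infinity_ennreal_def mult.commute)
qed simp

text \<open>Substituting \<open>T x\<close> in the integral of \<open>f x * (K x - L x)\<close>
  exchanges the kernels and yields minus the integral of \<open>f (T x) * (K x - L x)\<close>;
  adding the two forms gives the factor 2. \<open>T\<close> may be affine, as it is for the
  reflection of one coordinate.\<close>

lemma twice_integral_diff_reflection:
  fixes f K L :: "real ^ 'n \<Rightarrow> real"
  assumes T: "distr lborel borel T = lborel" and [measurable]: "T \<in> borel_measurable borel"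
    and [measurable]: "f \<in> borel_measurable borel" and f: "\<And>x. \<bar>f x\<bar> \<le> 1"
    and K: "integrable lborel K" and L: "integrable lborel L"
    and KT: "\<And>x. K (T x) = L x" and LT: "\<And>x. L (T x) = K x"
  shows "2 * ((LINT x|lborel. f x * K x) - (LINT x|lborel. f x * L x)) =
      (LINT x|lborel. (f x - f (T x)) * (K x - L x))"
    and "integrable lborel (\<lambda>x. (f x - f (T x)) * (K x - L x))"
proof -
  have [measurable]: "K \<in> borel_measurable borel" "L \<in> borel_measurable borel"
    using K L by auto
  have bound: "integrable lborel (\<lambda>x. g x * H x)"
    if "integrable lborel H" "g \<in> borel_measurable borel" "\<And>x. \<bar>g x\<bar> \<le> 1"
    for g H :: "real ^ 'n \<Rightarrow> real"
    using that by (intro Bochner_Integration.integrable_bound[OF that(1)])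
      (auto simp: abs_mult intro!: AE_I2 mult_left_le_one_le)
  have KL: "integrable lborel (\<lambda>x. K x - L x)"
    using K L by auto
  have i1: "integrable lborel (\<lambda>x. f x * (K x - L x))"
    using KL f by (intro bound) auto
  have i2: "integrable lborel (\<lambda>x. f (T x) * (K x - L x))"
    using KL f by (intro bound) auto
  show "integrable lborel (\<lambda>x. (f x - f (T x)) * (K x - L x))"
    using Bochner_Integration.integrable_diff[OF i1 i2] by (simp add: left_diff_distrib)
  have "(LINT x|lborel. f x * (K x - L x)) = (LINT x|distr lborel borel T. f x * (K x - L x))"
    by (simp add: T)
  also have "\<dots> = (LINT x|lborel. f (T x) * (L x - K x))"
    by (subst integral_distr) (simp_all add: KT LT)
  also have "\<dots> = - (LINT x|lborel. f (T x) * (K x - L x))"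
    by (simp add: algebra_simps flip: Bochner_Integration.integral_minus)
  finally have neg: "(LINT x|lborel. f x * (K x - L x)) = - (LINT x|lborel. f (T x) * (K x - L x))" .
  have "(LINT x|lborel. f x * K x) - (LINT x|lborel. f x * L x) = (LINT x|lborel. f x * (K x - L x))"
    using bound[OF K, of f] bound[OF L, of f] f by (simp add: right_diff_distrib)
  then show "2 * ((LINT x|lborel. f x * K x) - (LINT x|lborel. f x * L x)) =
      (LINT x|lborel. (f x - f (T x)) * (K x - L x))"
    using neg i1 i2 by (simp add: left_diff_distrib)
qed

section \<open>The standard normal density and probabilities of shifted sets\<close>

definition gauss_density :: "real ^ 'n \<Rightarrow> real" where
  "gauss_density z = (\<Prod>j\<in>UNIV. std_normal_density (z $ j))"

lemma gauss_density_eq: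
  "gauss_density (z :: real ^ 'n) = (1 / sqrt (2 * pi)) ^ CARD('n) * exp (- (\<Sum>j\<in>UNIV. (z $ j)\<^sup>2) / 2)"
  by (simp add: gauss_density_def std_normal_density_def prod.distrib sum_negf sum_divide_distrib
      exp_sum prod_dividef power_divide flip: sum_negf)

lemma gauss_density_pos: "0 < gauss_density z"
  by (auto simp: gauss_density_def normal_density_pos intro!: prod_pos)

lemma gauss_density_measurable [measurable]: "gauss_density \<in> borel_measurable borel"
  unfolding gauss_density_def by measurable

lemma std_normal_vec_eq: "std_normal_vec = density lborel (\<lambda>z. ennreal (gauss_density z))"
  by (simp add: std_normal_vec_def gauss_density_def)

lemma space_std_normal_vec [simp]: "space std_normal_vec = UNIV"
  and sets_std_normal_vec [simp, measurable_cong]: "sets std_normal_vec = sets borel"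
  by (simp_all add: std_normal_vec_def)

lemma nn_integral_gauss_density: "(\<integral>\<^sup>+z. gauss_density (z :: real ^ 'n) \<partial>lborel) = 1"
proof -
  have "gauss_density (z :: real ^ 'n) = (\<Prod>b\<in>Basis. std_normal_density (z \<bullet> b))" for z :: "real ^ 'n"
    unfolding gauss_density_def Basis_vec_def
    by (subst prod.UNION_disjoint) (auto simp: axis_eq_axis cart_eq_inner_axis)
  then have "(\<integral>\<^sup>+z. gauss_density (z :: real ^ 'n) \<partial>lborel) =
      (\<integral>\<^sup>+z. (\<Prod>b\<in>Basis. ennreal (std_normal_density (z \<bullet> b))) \<partial>(lborel :: (real ^ 'n) measure))"
    by (simp add: prod_ennreal)
  also have "\<dots> = (\<Prod>b\<in>(Basis :: (real ^ 'n) set). \<integral>\<^sup>+x. ennreal (std_normal_density x) \<partial>lborel)"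
    by (rule nn_integral_lborel_prod) auto
  also have "(\<integral>\<^sup>+x. ennreal (std_normal_density x) \<partial>lborel) = 1"
    using prob_space.emeasure_space_1[OF prob_space_normal_density[of 1 0]]
    by (simp add: emeasure_density)
  finally show ?thesis by simp
qed

lemma prob_space_std_normal_vec: "prob_space (std_normal_vec :: (real ^ 'n) measure)"
  by (intro prob_spaceI) (simp add: std_normal_vec_eq emeasure_density nn_integral_gauss_density)

lemma integrable_gauss_density: "integrable lborel (\<lambda>x. gauss_density (x - s :: real ^ 'n))"
proof -
  have "integrable lborel (gauss_density :: real ^ 'n \<Rightarrow> real)"
    using nn_integral_gauss_density[where 'n='n] gauss_density_pos[THEN less_imp_le]
    by (intro integrableI_nonneg) (auto intro!: AE_I2)
  then have "integrable (distr lborel borel ((+) (- s))) gauss_density"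
    by (simp add: lborel_distr_plus)
  then show ?thesis
    by (subst (asm) integrable_distr_eq) auto
qed

text \<open>Translation moves the shift from the set into the density, so that different shifts
  become different kernels against one fixed indicator.\<close>

lemma measure_std_normal_vec_shift:
  fixes A :: "(real ^ 'n) set"
  assumes [measurable]: "A \<in> sets borel"
  shows "measure std_normal_vec {z. z + s \<in> A} = (LINT x|lborel. indicator A x * gauss_density (x - s))"
proof -
  have [measurable]: "{z. z + s \<in> A} \<in> sets borel"
    using measurable_sets[of "\<lambda>z. z + s" borel borel A] by (simp add: vimage_def)
  have "measure std_normal_vec {z. z + s \<in> A} = (LINT z|std_normal_vec. indicator {z. z + s \<in> A} z)"
    by simp
  also have "\<dots> = (LINT z|lborel. gauss_density z * indicator {z. z + s \<in> A} z)"
    unfolding std_normal_vec_eq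
    by (subst integral_density) (auto simp: less_imp_le gauss_density_pos intro!: AE_I2)
  also have "\<dots> = (LINT z|distr lborel borel ((+) (- s)). gauss_density z * indicator {z. z + s \<in> A} z)"
    by (simp add: lborel_distr_plus)
  also have "\<dots> = (LINT x|lborel. indicator A x * gauss_density (x - s))"
    by (subst integral_distr) (auto simp: indicator_def mult.commute intro!: Bochner_Integration.integral_cong)
  finally show ?thesis .
qed

subsection \<open>Transfers in the plane\<close>

text \<open>Because of the equal sums, \<open>x\<close> and \<open>y\<close> are convex combinations
  of \<open>z\<close> and \<open>w\<close> with the two weights interchanged, and the two chord
  inequalities add up.\<close>

lemma convex_on_transfer:
  fixes h :: "real \<Rightarrow> real"
  assumes h: "convex_on I h" and I: "z \<in> I" "w \<in> I"
    and sum: "x + y = z + w" and "w \<le> y" "w \<le> x"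
  shows "h x + h y \<le> h z + h w"
proof (cases "z = w")
  case True
  then show ?thesis using assms by (smt (verit))
next
  case False
  define l where "l = (x - w) / (z - w)"
  have zw: "z - w > 0" using assms False by auto
  have l: "0 \<le> l" "l \<le> 1" using zw assms by (auto simp: l_def divide_simps)
  have "l * (z - w) = x - w"
    using zw by (simp add: l_def)
  then have x: "x = (1 - l) * w + l * z"
    by (simp add: algebra_simps)
  then have y: "y = (1 - l) * z + l * w"
    using sum by (simp add: algebra_simps)
  have "h x \<le> (1 - l) * h w + l * h z"
    unfolding x using convex_onD[OF h l I(2) I(1)] by simp
  moreover have "h y \<le> (1 - l) * h z + l * h w"
    unfolding y using convex_onD[OF h l I(1) I(2)] by simp
  ultimately show ?thesis by (simp add: algebra_simps)
qed

text \<open>With the sum fixed, \<open>(x - y)\<^sup>2 = (x + y)\<^sup>2 - 4 * (x * y)\<close> shows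
  that the larger product belongs to the closer pair. Comparing products therefore expresses nesting
  without ordering the pair.\<close>

lemma transfer_order:
  fixes x y z w :: real
  assumes "x + y = z + w" "z * w \<le> x * y"
  shows "min z w \<le> min x y" "max x y \<le> max z w"
proof -
  have "(x - y)\<^sup>2 \<le> (z - w)\<^sup>2"
  proof -
    have "(a - b)\<^sup>2 = (a + b)\<^sup>2 - 4 * (a * b)" for a b :: real
      by (simp add: power2_eq_square algebra_simps)
    then show ?thesis using assms by simp
  qed
  then have "\<bar>x - y\<bar> \<le> \<bar>z - w\<bar>"
    by (simp add: abs_le_square_iff)
  then show "min z w \<le> min x y" "max x y \<le> max z w"
    using assms(1) by linarith+
qed

lemma convex_on_transfer':
  fixes h :: "real \<Rightarrow> real"
  assumes h: "convex_on I h" and I: "z \<in> I" "w \<in> I"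
    and sum: "x + y = z + w" and prod: "z * w \<le> x * y"
  shows "h x + h y \<le> h z + h w"
  using transfer_order[OF sum prod] convex_on_transfer[OF h I sum]
    convex_on_transfer[OF h I(2,1), of x y] sum
  by (cases "w \<le> z") (auto simp: add.commute)

text \<open>In the power series, \<open>cosh a\<close> is a combination of the powers of
  \<open>a\<^sup>2\<close> with nonnegative coefficients, and each power is convex on the
  nonnegative reals. So the inequality holds term by term for the squares.\<close>

lemma cosh_add_mono:
  fixes a b c d :: real
  assumes sum: "a\<^sup>2 + b\<^sup>2 = c\<^sup>2 + d\<^sup>2" and prod: "\<bar>c * d\<bar> \<le> \<bar>a * b\<bar>"
  shows "cosh a + cosh b \<le> cosh c + cosh d"
proof -
  have cv: "convex_on {0..} (\<lambda>x::real. x ^ n)" for n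
    using convex_power_odd[of n] convex_power_even[of n]
    by (cases "even n") (auto intro: convex_on_subset)
  have "(c * d)\<^sup>2 \<le> (a * b)\<^sup>2"
    using prod by (simp add: abs_le_square_iff)
  then have pow: "(a\<^sup>2) ^ m + (b\<^sup>2) ^ m \<le> (c\<^sup>2) ^ m + (d\<^sup>2) ^ m" for m
    using sum by (intro convex_on_transfer'[OF cv]) (auto simp: power_mult_distrib)
  have "(\<lambda>n. (if even n then a ^ n /\<^sub>R fact n else 0) + (if even n then b ^ n /\<^sub>R fact n else 0)) sums (cosh a + cosh b)"
    "(\<lambda>n. (if even n then c ^ n /\<^sub>R fact n else 0) + (if even n then d ^ n /\<^sub>R fact n else 0)) sums (cosh c + cosh d)"
    by (intro sums_add cosh_converges)+
  then show ?thesis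
  proof (rule sums_le[rotated])
    fix n
    show "(if even n then a ^ n /\<^sub>R fact n else 0) + (if even n then b ^ n /\<^sub>R fact n else 0) \<le>
      (if even n then c ^ n /\<^sub>R fact n else 0) + (if even n then d ^ n /\<^sub>R fact n else 0)"
    proof (cases "even n")
      case True
      then obtain m where m: "n = 2 * m" by auto
      show ?thesis
        using pow[of m] by (simp add: m power_mult divide_right_mono flip: add_divide_distrib distrib_left)
    qed simp
  qed
qed

text \<open>
  In complex notation, with \<open>X = x + \<i> y\<close>, \<open>S = s + \<i> s'\<close>, \<open>T = t + \<i> t'\<close>, the reflection exchanging \<open>S\<close>
  and \<open>T\<close> maps \<open>X\<close> to \<open>S T cnj X / r\<close>.  Since \<open>Re (X ^ 4) = \<bar>X\<bar> ^ 4 - 8 (x y)\<^sup>2\<close>, each of the three differences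
  of squared products is a difference of cosines of angles multiplied by four, and the identity is
  the sum-to-product formula for these.
\<close>

lemma plane_reflection_identity:
  fixes x y s s' t t' p q r :: real
  assumes r: "s\<^sup>2 + s'\<^sup>2 = r" "t\<^sup>2 + t'\<^sup>2 = r"
    and p: "p = s * t - s' * t'" and q: "q = s * t' + s' * t"
  shows "(r ^ 4 * (x * y)\<^sup>2 - ((p * x + q * y) * (q * x - p * y))\<^sup>2) *
      (((x * t + y * t') * (x * t' - y * t))\<^sup>2 - ((x * s + y * s') * (x * s' - y * s))\<^sup>2) =
     ((2 * p * (x * y) - q * (x\<^sup>2 - y\<^sup>2)) * (2 * q * (x * y) + p * (x\<^sup>2 - y\<^sup>2)))\<^sup>2 *
     ((s * s')\<^sup>2 - (t * t')\<^sup>2)" (is "?F * ?G = (?I * ?R)\<^sup>2 * ?H")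
proof -
  \<comment> \<open>In the complex notation \<open>c + i d\<close> is the square of S,
    \<open>c' + i d'\<close> that of T, and \<open>m + 2 i e\<close> that of X, while
    \<open>p + i q\<close> is the product S T. The factors \<open>?R\<close> and \<open>?I\<close>
    are the real and imaginary parts of X squared times the conjugate of S T.\<close>
  define c d c' d' e m where defs: "c = s\<^sup>2 - s'\<^sup>2" "d = 2 * (s * s')" "c' = t\<^sup>2 - t'\<^sup>2" "d' = 2 * (t * t')"
    "e = x * y" "m = x\<^sup>2 - y\<^sup>2"
  have "c\<^sup>2 + d\<^sup>2 = (s\<^sup>2 + s'\<^sup>2)\<^sup>2" "c'\<^sup>2 + d'\<^sup>2 = (t\<^sup>2 + t'\<^sup>2)\<^sup>2"
    unfolding defs by (simp_all add: power2_eq_square algebra_simps)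
  then have cd: "c\<^sup>2 + d\<^sup>2 - c'\<^sup>2 - d'\<^sup>2 = 0"
    unfolding r by simp
  have "p\<^sup>2 + q\<^sup>2 = (s\<^sup>2 + s'\<^sup>2) * (t\<^sup>2 + t'\<^sup>2)"
    unfolding p q by (simp add: power2_eq_square algebra_simps)
  then have pq: "p\<^sup>2 + q\<^sup>2 = r\<^sup>2"
    unfolding r by (simp add: power2_eq_square)
  have pqs: "2 * (p * q) = c * d' + c' * d" "p\<^sup>2 - q\<^sup>2 = c * c' - d * d'"
    unfolding p q defs by (simp_all add: power2_eq_square algebra_simps)
  have r4: "r ^ 4 = (p\<^sup>2 + q\<^sup>2)\<^sup>2"
    unfolding pq by simp
  have F: "?F = p * q * (?I * ?R)"
    unfolding r4 by (simp add: power2_eq_square algebra_simps)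
  define IR G H where IR: "IR = ?I * ?R" and G_def: "G = ?G" and H_def: "H = ?H"
  have g: "G = (m * d' / 2 - e * c')\<^sup>2 - (m * d / 2 - e * c)\<^sup>2"
    unfolding G_def defs by (simp add: power2_eq_square field_simps)
  have "IR = 2 * (2 * (p * q)) * e\<^sup>2 + 2 * (p\<^sup>2 - q\<^sup>2) * (e * m) - (2 * (p * q)) * m\<^sup>2 / 2"
    unfolding IR defs by (simp add: power2_eq_square field_simps)
  then have IRe: "IR = 2 * (c * d' + c' * d) * e\<^sup>2 + 2 * (c * c' - d * d') * (e * m) - (c * d' + c' * d) * m\<^sup>2 / 2"
    unfolding pqs .
  \<comment> \<open>The two terms agree only up to a multiple of the difference of the fourth powers
    of the moduli of S and T, which \<open>cd\<close> makes zero.\<close>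
  have "(c * d' + c' * d) * G * 4 - (d\<^sup>2 - d'\<^sup>2) * 2 * IR =
      4 * (d * d' * e * m - (c * d' + c' * d) * e\<^sup>2) * (c\<^sup>2 + d\<^sup>2 - c'\<^sup>2 - d'\<^sup>2)"
    unfolding g IRe by (simp add: power2_eq_square field_simps)
  then have "2 * (p * q) * G * 4 = (d\<^sup>2 - d'\<^sup>2) * 2 * IR"
    unfolding cd pqs by simp
  moreover have "d\<^sup>2 - d'\<^sup>2 = 4 * H"
    unfolding H_def defs by (simp add: power_mult_distrib)
  ultimately have "p * q * G = H * IR"
    by simp
  then have G: "p * q * ?G = ?H * (?I * ?R)"
    unfolding IR G_def H_def .
  have "?F * ?G = (p * q * ?G) * (?I * ?R)"
    unfolding F by (simp add: mult_ac)
  then show ?thesis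
    unfolding G by (simp add: power2_eq_square mult_ac)
qed

subsection \<open>Transfers between two coordinates\<close>

definition plane_map :: "'n \<Rightarrow> 'n \<Rightarrow> real \<Rightarrow> real \<Rightarrow> real \<Rightarrow> real \<Rightarrow> real ^ 'n \<Rightarrow> real ^ 'n" where
  "plane_map i j a b c d x =
    (\<chi> l. if l = i then a * x $ i + b * x $ j else if l = j then c * x $ i + d * x $ j else x $ l)"

lemma plane_map_nth:
  assumes "i \<noteq> j"
  shows "plane_map i j a b c d x $ i = a * x $ i + b * x $ j"
    and "plane_map i j a b c d x $ j = c * x $ i + d * x $ j"
    and "l \<noteq> i \<Longrightarrow> l \<noteq> j \<Longrightarrow> plane_map i j a b c d x $ l = x $ l"
  using assms by (simp_all add: plane_map_def)

lemma sum_split_pair: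
  fixes g :: "'n::finite \<Rightarrow> real"
  assumes "i \<noteq> j"
  shows "(\<Sum>l\<in>UNIV. g l) = g i + g j + (\<Sum>l\<in>- {i, j}. g l)"
proof -
  have "sum g UNIV = sum g (- {i, j}) + sum g {i, j}"
    using sum.subset_diff[of "{i, j}" UNIV g] by (simp add: Compl_eq_Diff_UNIV)
  then show ?thesis using assms by simp
qed

lemma orthogonal_plane_map:
  assumes ij: "i \<noteq> j" and "a\<^sup>2 + c\<^sup>2 = 1" "b\<^sup>2 + d\<^sup>2 = 1" "a * b + c * d = 0"
  shows "orthogonal_transformation (plane_map i j a b c d)"
  unfolding orthogonal_transformation_def
proof (intro conjI allI)
  show "linear (plane_map i j a b c d)"
    by (rule linearI) (simp_all add: plane_map_def vec_eq_iff algebra_simps)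
  fix v w
  have "(a * v $ i + b * v $ j) * (a * w $ i + b * w $ j) + (c * v $ i + d * v $ j) * (c * w $ i + d * w $ j)
     = (a\<^sup>2 + c\<^sup>2) * (v $ i * w $ i) + (b\<^sup>2 + d\<^sup>2) * (v $ j * w $ j) + (a * b + c * d) * (v $ i * w $ j + v $ j * w $ i)"
    by (simp add: power2_eq_square algebra_simps)
  then show "plane_map i j a b c d v \<bullet> plane_map i j a b c d w = v \<bullet> w"
    using assms(2-) by (simp add: inner_vec_def sum_split_pair[OF ij] plane_map_nth[OF ij])
qed

lemma orthogonal_transformation_measurable:
  "orthogonal_transformation (T :: real ^ 'n \<Rightarrow> real ^ 'n) \<Longrightarrow> T \<in> borel_measurable borel"
  by (intro borel_measurable_continuous_onI linear_continuous_on)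
     (simp add: linear_conv_bounded_linear[symmetric] orthogonal_transformation_linear)

lemma gauss_density_norm: "gauss_density (z :: real ^ 'n) = (1 / sqrt (2 * pi)) ^ CARD('n) * exp (- (norm z)\<^sup>2 / 2)"
  by (simp add: gauss_density_eq norm_vec_def L2_set_def sum_nonneg)

text \<open>Substituting \<open>T x\<close> leaves both Lebesgue measure and \<open>f\<close>
  unchanged. This permits replacing one Gaussian kernel by an average over rotated centres.\<close>

lemma integral_gauss_density_orthogonal:
  fixes f :: "real ^ 'n \<Rightarrow> real"
  assumes T: "orthogonal_transformation T" and [measurable]: "f \<in> borel_measurable borel"
    and f: "\<And>x. f (T x) = f x"
  shows "(LINT x|lborel. f x * gauss_density (x - T s)) = (LINT x|lborel. f x * gauss_density (x - s))"
proof -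
  have [measurable]: "T \<in> borel_measurable borel"
    using T by (rule orthogonal_transformation_measurable)
  have g: "gauss_density (T x - T s) = gauss_density (x - s)" for x
    using orthogonal_transformation_norm[OF T, of "x - s"] orthogonal_transformation_linear[OF T]
    by (simp add: gauss_density_norm linear_diff)
  have "(LINT x|lborel. f x * gauss_density (x - T s)) =
      (LINT x|distr lborel borel T. f x * gauss_density (x - T s))"
    by (simp add: distr_lborel_orthogonal[OF T])
  also have "\<dots> = (LINT x|lborel. f x * gauss_density (x - s))"
    by (subst integral_distr) (simp_all add: f g)
  finally show ?thesis .
qed

text \<open>Read from \<open>x\<close> to \<open>y\<close>, this makes the squares of two
  coordinates more equal: their sum is kept and their product does not fall. The condition ignores
  signs and the order of the two coordinates, and it is stable under scaling.\<close>

definition pair_transfer :: "'n \<Rightarrow> 'n \<Rightarrow> real ^ 'n \<Rightarrow> real ^ 'n \<Rightarrow> bool" where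
  "pair_transfer i j x y \<longleftrightarrow> i \<noteq> j \<and> (\<forall>l. l \<noteq> i \<longrightarrow> l \<noteq> j \<longrightarrow> y $ l = x $ l) \<and>
    (y $ i)\<^sup>2 + (y $ j)\<^sup>2 = (x $ i)\<^sup>2 + (x $ j)\<^sup>2 \<and> \<bar>x $ i * x $ j\<bar> \<le> \<bar>y $ i * y $ j\<bar>"

theorem measure_shift_pair_transfer:
  fixes A :: "(real ^ 'n) set"
  assumes A[measurable]: "A \<in> sets borel"
    and upper: "\<And>x y. x \<in> A \<Longrightarrow> pair_transfer i j x y \<Longrightarrow> y \<in> A"
    and ts: "pair_transfer i j t s"
  shows "measure std_normal_vec {z. z + t \<in> A} \<le> measure std_normal_vec {z. z + s \<in> A}"
proof -
  have ij: "i \<noteq> j" and out: "\<And>l. l \<noteq> i \<Longrightarrow> l \<noteq> j \<Longrightarrow> s $ l = t $ l"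
    and abs: "\<bar>t $ i * t $ j\<bar> \<le> \<bar>s $ i * s $ j\<bar>"
    using ts by (auto simp: pair_transfer_def)
  define r where "r = (s $ i)\<^sup>2 + (s $ j)\<^sup>2"
  have rs: "(s $ i)\<^sup>2 + (s $ j)\<^sup>2 = r" and rt: "(t $ i)\<^sup>2 + (t $ j)\<^sup>2 = r"
    using ts by (auto simp: pair_transfer_def r_def)
  show ?thesis
  proof (cases "r = 0")
    case True
    then have "s = t"
      using rs rt out by (auto simp: vec_eq_iff) (metis sum_power2_eq_zero_iff)
    then show ?thesis by simp
  next
    case False
    then have r: "r > 0" using rs by (metis less_eq_real_def sum_power2_ge_zero)
    define f where "f = (indicator A :: real ^ 'n \<Rightarrow> real)"
    have f[measurable]: "f \<in> borel_measurable borel" by (simp add: f_def)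
    have f1: "\<bar>f x\<bar> \<le> 1" for x by (simp add: f_def indicator_def)
    \<comment> \<open>A quarter turn in the coordinate plane. It keeps the radius and
      \<open>\<bar>x $ i * x $ j\<bar>\<close>, so \<open>x\<close> and \<open>J x\<close> are
      transfers of each other and \<open>A\<close> is invariant.\<close>
    define J where "J = plane_map i j 0 (- 1) 1 0"
    have Jn: "J x $ i = - x $ j" "J x $ j = x $ i" "l \<noteq> i \<Longrightarrow> l \<noteq> j \<Longrightarrow> J x $ l = x $ l" for x l
      unfolding J_def by (simp_all add: plane_map_nth[OF ij])
    have J: "orthogonal_transformation J"
      unfolding J_def using ij by (intro orthogonal_plane_map) auto
    have "x \<in> A \<longleftrightarrow> J x \<in> A" for x
      using upper[of x "J x"] upper[of "J x" x] ij
      by (auto simp: pair_transfer_def Jn abs_mult mult.commute)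
    then have fJ: "f (J x) = f x" for x by (simp add: f_def indicator_def)
    \<comment> \<open>The four centres form the orbit of \<open>v\<close> under the quarter turn, so
      \<open>f\<close> has the same integral against each summand. Opposite centres combine into the
      hyperbolic cosines of \<open>KW\<close>.\<close>
    define K where "K v x = gauss_density (x - v) + gauss_density (x - J v) +
        gauss_density (x - J (J v)) + gauss_density (x - J (J (J v)))" for v x
    have Kint: "integrable lborel (K v)" for v
      unfolding K_def by (intro Bochner_Integration.integrable_add integrable_gauss_density)
    have fint: "integrable lborel (\<lambda>x. f x * gauss_density (x - v))" for v
      using integrable_gauss_density[of v] f1
      by (intro Bochner_Integration.integrable_bound[OF integrable_gauss_density[of v]])
         (auto simp: abs_mult intro!: AE_I2 mult_left_le_one_le)
    have KP: "(LINT x|lborel. f x * K v x) = 4 * measure std_normal_vec {z. z + v \<in> A}" for v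
    proof -
      note J' = integral_gauss_density_orthogonal[OF J f fJ]
      have "(LINT x|lborel. f x * K v x) = 4 * (LINT x|lborel. f x * gauss_density (x - v))"
        unfolding K_def distrib_left using fint by (simp add: J')
      then show ?thesis
        by (simp add: measure_std_normal_vec_shift[OF A] f_def)
    qed
    \<comment> \<open>The factor that the kernels of \<open>s\<close> and \<open>t\<close> share:
      the two centres agree outside the plane and have the same radius in it.\<close>
    define W where "W x = (1 / sqrt (2 * pi)) ^ CARD('n) * exp (- (\<Sum>l\<in>- {i, j}. (x $ l - s $ l)\<^sup>2) / 2) *
        exp (- ((x $ i)\<^sup>2 + (x $ j)\<^sup>2 + r) / 2)" for x :: "real ^ 'n"
    have W0: "W x > 0" for x by (simp add: W_def)
    have gW: "gauss_density (x - v) = W x * exp (x $ i * v $ i + x $ j * v $ j)"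
      if "\<And>l. l \<noteq> i \<Longrightarrow> l \<noteq> j \<Longrightarrow> v $ l = s $ l" "(v $ i)\<^sup>2 + (v $ j)\<^sup>2 = r" for v x
    proof -
      have 1: "(\<Sum>l\<in>- {i, j}. (x $ l - v $ l)\<^sup>2) = (\<Sum>l\<in>- {i, j}. (x $ l - s $ l)\<^sup>2)"
        using that(1) by (intro sum.cong) auto
      show ?thesis
        unfolding gauss_density_eq W_def sum_split_pair[OF ij] vector_minus_component 1 that(2)[symmetric]
        by (simp add: power2_diff field_simps flip: exp_add)
    qed
    have KW: "K v x = W x * (2 * (cosh (x $ i * v $ i + x $ j * v $ j) + cosh (x $ i * v $ j - x $ j * v $ i)))"
      if "\<And>l. l \<noteq> i \<Longrightarrow> l \<noteq> j \<Longrightarrow> v $ l = s $ l" "(v $ i)\<^sup>2 + (v $ j)\<^sup>2 = r" for v x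
    proof -
      have "K v x = W x * exp (x $ i * v $ i + x $ j * v $ j) + W x * exp (- (x $ i * v $ j - x $ j * v $ i))
        + W x * exp (- (x $ i * v $ i + x $ j * v $ j)) + W x * exp (x $ i * v $ j - x $ j * v $ i)"
        unfolding K_def using that by (subst (1 2 3 4) gW) (simp_all add: Jn add.commute)
      then show ?thesis by (simp add: cosh_def algebra_simps)
    qed
    have Ks: "K s x = W x * (2 * (cosh (x $ i * s $ i + x $ j * s $ j) + cosh (x $ i * s $ j - x $ j * s $ i)))" for x
      by (rule KW) (simp_all add: rs)
    have Kt: "K t x = W x * (2 * (cosh (x $ i * t $ i + x $ j * t $ j) + cosh (x $ i * t $ j - x $ j * t $ i)))" for x
      by (rule KW) (simp_all add: rt out)
    \<comment> \<open>As a complex number \<open>p + i q\<close> is the product of the planar parts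
      of \<open>s\<close> and \<open>t\<close>. The reflection \<open>T\<close> built from it
      interchanges these two parts, as \<open>st\<close> and \<open>ts'\<close> verify.\<close>
    define p q where pq: "p = s $ i * t $ i - s $ j * t $ j" "q = s $ i * t $ j + s $ j * t $ i"
    define T where "T = plane_map i j (p / r) (q / r) (q / r) (- p / r)"
    have Tn: "T x $ i = (p * x $ i + q * x $ j) / r" "T x $ j = (q * x $ i - p * x $ j) / r"
      "l \<noteq> i \<Longrightarrow> l \<noteq> j \<Longrightarrow> T x $ l = x $ l" for x l
      unfolding T_def by (simp_all add: plane_map_nth[OF ij] add_divide_distrib diff_divide_distrib)
    have "p\<^sup>2 + q\<^sup>2 = ((s $ i)\<^sup>2 + (s $ j)\<^sup>2) * ((t $ i)\<^sup>2 + (t $ j)\<^sup>2)"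
      unfolding pq by (simp add: power2_eq_square algebra_simps)
    then have pqr: "p\<^sup>2 + q\<^sup>2 = r\<^sup>2" unfolding rs rt by (simp add: power2_eq_square)
    have T: "orthogonal_transformation T"
      unfolding T_def using ij r pqr
      by (intro orthogonal_plane_map) (auto simp: power_divide add.commute simp flip: add_divide_distrib)
    have Tsq: "(T x $ i)\<^sup>2 + (T x $ j)\<^sup>2 = (x $ i)\<^sup>2 + (x $ j)\<^sup>2" for x
    proof -
      have "(p * x $ i + q * x $ j)\<^sup>2 + (q * x $ i - p * x $ j)\<^sup>2 = r\<^sup>2 * ((x $ i)\<^sup>2 + (x $ j)\<^sup>2)"
        unfolding pqr[symmetric] by (simp add: power2_eq_square algebra_simps)
      then show ?thesis using r by (simp add: Tn power_divide flip: add_divide_distrib)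
    qed
    have WT: "W (T x) = W x" for x
      unfolding W_def Tsq by (simp add: Tn cong: sum.cong_simp)
    have st: "s $ i * p + s $ j * q = r * t $ i" "s $ j * p - s $ i * q = - (r * t $ j)"
      unfolding pq rs[symmetric] by (simp_all add: power2_eq_square algebra_simps)
    have ts': "t $ i * p + t $ j * q = r * s $ i" "t $ j * p - t $ i * q = - (r * s $ j)"
      unfolding pq rt[symmetric] by (simp_all add: power2_eq_square algebra_simps)
    have inner: "T x $ i * v $ i + T x $ j * v $ j = x $ i * w $ i + x $ j * w $ j"
      "T x $ i * v $ j - T x $ j * v $ i = - (x $ i * w $ j - x $ j * w $ i)"
      if "v $ i * p + v $ j * q = r * w $ i" "v $ j * p - v $ i * q = - (r * w $ j)" for x v w
    proof -
      have "r * (T x $ i * v $ i + T x $ j * v $ j) = (v $ i * p + v $ j * q) * x $ i - (v $ j * p - v $ i * q) * x $ j"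
        using r by (simp add: Tn field_simps)
      also have "\<dots> = r * (x $ i * w $ i + x $ j * w $ j)"
        unfolding that by (simp add: algebra_simps)
      finally show "T x $ i * v $ i + T x $ j * v $ j = x $ i * w $ i + x $ j * w $ j"
        using r by simp
      have "r * (T x $ i * v $ j - T x $ j * v $ i) = (v $ j * p - v $ i * q) * x $ i + (v $ i * p + v $ j * q) * x $ j"
        using r by (simp add: Tn field_simps)
      also have "\<dots> = r * (- (x $ i * w $ j - x $ j * w $ i))"
        unfolding that by (simp add: algebra_simps)
      finally show "T x $ i * v $ j - T x $ j * v $ i = - (x $ i * w $ j - x $ j * w $ i)"
        using r by simp
    qed
    have KT: "K s (T x) = K t x" "K t (T x) = K s x" for x
      unfolding Ks Kt WT inner[OF st] inner[OF ts'] cosh_minus by (rule refl)+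
    have nonneg: "0 \<le> (f x - f (T x)) * (K s x - K t x)" for x
    proof -
      let ?e = "(x $ i * x $ j)\<^sup>2" and ?e' = "(T x $ i * T x $ j)\<^sup>2"
      let ?a = "x $ i * s $ i + x $ j * s $ j" and ?b = "x $ i * s $ j - x $ j * s $ i"
      let ?a' = "x $ i * t $ i + x $ j * t $ j" and ?b' = "x $ i * t $ j - x $ j * t $ i"
      have ab: "?a\<^sup>2 + ?b\<^sup>2 = ?a'\<^sup>2 + ?b'\<^sup>2"
      proof -
        have "?a\<^sup>2 + ?b\<^sup>2 = ((x $ i)\<^sup>2 + (x $ j)\<^sup>2) * r" "?a'\<^sup>2 + ?b'\<^sup>2 = ((x $ i)\<^sup>2 + (x $ j)\<^sup>2) * r"
          unfolding rs[symmetric] by (simp add: power2_eq_square algebra_simps)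
            (unfold rs rt[symmetric], simp add: power2_eq_square algebra_simps)
        then show ?thesis by simp
      qed
      \<comment> \<open>The factor \<open>r ^ 4\<close> clears the denominators of \<open>T\<close>.
        By \<open>plane_reflection_identity\<close> the product is a square times a difference that
        is nonnegative because \<open>s\<close> arises from \<open>t\<close> by a transfer.\<close>
      have "(r ^ 4 * ?e - r ^ 4 * ?e') * ((?a' * ?b')\<^sup>2 - (?a * ?b)\<^sup>2) \<ge> 0"
      proof -
        have e': "r ^ 4 * ?e' = ((p * x $ i + q * x $ j) * (q * x $ i - p * x $ j))\<^sup>2"
          using r by (simp add: Tn power_divide power_mult_distrib)
        have "0 \<le> (s $ i * s $ j)\<^sup>2 - (t $ i * t $ j)\<^sup>2"
          using abs by (simp add: abs_le_square_iff)
        then show ?thesis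
          unfolding e' plane_reflection_identity[OF rs rt pq] by simp
      qed
      then have sgn: "0 \<le> (?e - ?e') * ((?a' * ?b')\<^sup>2 - (?a * ?b)\<^sup>2)"
        using r by (simp flip: right_diff_distrib add: mult.assoc zero_le_mult_iff)
      have K: "K s x - K t x = W x * 2 * ((cosh ?a + cosh ?b) - (cosh ?a' + cosh ?b'))"
        unfolding Ks Kt by (simp add: algebra_simps)
      consider "f x = f (T x)" | "x \<in> A" "T x \<notin> A" | "x \<notin> A" "T x \<in> A"
        by (cases "x \<in> A"; cases "T x \<in> A") (auto simp: f_def)
      then show ?thesis
      proof cases
        case 1
        then show ?thesis by simp
      next
        case 2
        \<comment> \<open>Since \<open>T\<close> moves \<open>x\<close> out of \<open>A\<close>, it
          must lower the product of the two coordinates. By \<open>sgn\<close> the pair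
          \<open>?a\<close>, \<open>?b\<close> then has the smaller product, hence the larger sum of
          hyperbolic cosines.\<close>
        then have "\<not> \<bar>x $ i * x $ j\<bar> \<le> \<bar>T x $ i * T x $ j\<bar>"
          using upper[of x "T x"] ij by (auto simp: pair_transfer_def Tsq Tn(3))
        then have "?e > ?e'" by (simp add: abs_le_square_iff)
        then have "\<bar>?a * ?b\<bar> \<le> \<bar>?a' * ?b'\<bar>"
          using sgn by (simp add: abs_le_square_iff zero_le_mult_iff)
        then show ?thesis
          using cosh_add_mono[OF ab[symmetric]] 2 W0[of x] unfolding K by (simp add: f_def)
      next
        case 3
        then have "\<not> \<bar>T x $ i * T x $ j\<bar> \<le> \<bar>x $ i * x $ j\<bar>"
          using upper[of "T x" x] ij by (auto simp: pair_transfer_def Tsq Tn(3))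
        then have "?e < ?e'" by (simp add: abs_le_square_iff)
        then have "\<bar>?a' * ?b'\<bar> \<le> \<bar>?a * ?b\<bar>"
          using sgn by (simp add: abs_le_square_iff zero_le_mult_iff)
        then show ?thesis
          using cosh_add_mono[OF ab] 3 W0[of x] unfolding K by (simp add: f_def mult_nonneg_nonpos)
      qed
    qed
    have "2 * ((LINT x|lborel. f x * K s x) - (LINT x|lborel. f x * K t x)) =
        (LINT x|lborel. (f x - f (T x)) * (K s x - K t x))"
      by (rule twice_integral_diff_reflection[OF distr_lborel_orthogonal[OF T]
        orthogonal_transformation_measurable[OF T] f f1 Kint Kint KT])
    also have "\<dots> \<ge> 0"
      by (rule Bochner_Integration.integral_nonneg) (rule nonneg)
    finally show ?thesis by (simp add: KP)
  qed
qed

subsection \<open>Shifts along one coordinate\<close>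

lemma AE_lborel_not_in_open:
  fixes U :: "'a::euclidean_space set"
  assumes "AE x in lborel. x \<notin> U" and U: "open U"
  shows "U = {}"
proof -
  have "U \<in> null_sets lborel"
    using assms by (subst AE_iff_null_sets) auto
  then have "negligible U"
    by (auto simp: negligible_iff_null_sets intro: null_sets_completionI)
  then show ?thesis using U open_not_negligible by blast
qed

lemma measure_std_normal_vec_eq_0_iff:
  fixes S :: "(real ^ 'n) set"
  assumes S[measurable]: "S \<in> sets borel"
  shows "measure std_normal_vec S = 0 \<longleftrightarrow> (AE x in lborel. x \<notin> S)"
proof -
  interpret prob_space "std_normal_vec :: (real ^ 'n) measure"
    by (rule prob_space_std_normal_vec)
  have "measure std_normal_vec S = 0 \<longleftrightarrow> (AE x in std_normal_vec. x \<notin> S)"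
    by (subst prob_eq_0) auto
  also have "\<dots> \<longleftrightarrow> (AE x in lborel. x \<notin> S)"
    unfolding std_normal_vec_eq by (subst AE_density) (auto simp: gauss_density_pos)
  finally show ?thesis .
qed

lemma measure_std_normal_vec_negligible:
  fixes S :: "(real ^ 'n) set"
  assumes "S \<in> sets borel" "negligible S"
  shows "measure std_normal_vec S = 0"
proof -
  have "S \<in> null_sets lborel"
    using assms by (auto simp: negligible_iff_null_sets null_sets_def)
  then show ?thesis
    using assms(1) by (subst measure_std_normal_vec_eq_0_iff) (auto intro: AE_not_in)
qed

lemma measure_std_normal_vec_open_pos:
  fixes U :: "(real ^ 'n) set"
  assumes "open U" "U \<noteq> {}"
  shows "0 < measure std_normal_vec U"
proof -
  have "measure std_normal_vec U \<noteq> 0"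
    using assms AE_lborel_not_in_open by (subst measure_std_normal_vec_eq_0_iff) auto
  then show ?thesis by (simp add: less_le)
qed

text \<open>Reflecting coordinate \<open>j\<close> in the midpoint of \<open>s $ j\<close> and
  \<open>t $ j\<close> interchanges the two kernels. A point can leave \<open>A\<close> under this
  reflection only if its coordinate \<open>j\<close> shrinks in absolute value, and such a point
  lies on the side of \<open>s\<close>. For the strict form, \<open>U\<close> is an open set on
  which the integrand is positive.\<close>

lemma
  fixes A :: "(real ^ 'n) set"
  assumes A[measurable]: "A \<in> sets borel"
    and upper: "\<And>x y. x \<in> A \<Longrightarrow> (\<And>l. l \<noteq> j \<Longrightarrow> y $ l = x $ l) \<Longrightarrow> \<bar>x $ j\<bar> \<le> \<bar>y $ j\<bar> \<Longrightarrow> y \<in> A"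
    and out: "\<And>l. l \<noteq> j \<Longrightarrow> s $ l = t $ l" and ts: "\<bar>t $ j\<bar> \<le> \<bar>s $ j\<bar>"
  shows measure_shift_coordinate_mono:
      "measure std_normal_vec {z. z + t \<in> A} \<le> measure std_normal_vec {z. z + s \<in> A}"
    and measure_shift_coordinate_strict_mono:
      "\<bar>t $ j\<bar> < \<bar>s $ j\<bar> \<Longrightarrow> open U \<Longrightarrow> x\<^sub>0 \<in> U \<Longrightarrow>
       (\<And>x. x \<in> U \<Longrightarrow> x \<in> A \<and> (\<chi> l. if l = j then s $ j + t $ j - x $ j else x $ l) \<notin> A) \<Longrightarrow>
       measure std_normal_vec {z. z + t \<in> A} < measure std_normal_vec {z. z + s \<in> A}"
proof -
  define f where "f = (indicator A :: real ^ 'n \<Rightarrow> real)"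
  have f[measurable]: "f \<in> borel_measurable borel" by (simp add: f_def)
  have f1: "\<bar>f x\<bar> \<le> 1" for x by (simp add: f_def indicator_def)
  define T where "T x = (\<chi> l. if l = j then s $ j + t $ j - x $ j else x $ l)" for x :: "real ^ 'n"
  define S where "S x = (\<chi> l. if l = j then - x $ j else x $ l)" for x :: "real ^ 'n"
  have "linear S"
    by (rule linearI) (auto simp: S_def vec_eq_iff)
  moreover have "S v \<bullet> S w = v \<bullet> w" for v w
    by (auto simp: inner_vec_def S_def intro!: sum.cong)
  ultimately have S: "orthogonal_transformation S"
    by (simp add: orthogonal_transformation_def)
  \<comment> \<open>A linear reflection followed by a translation, each of which preserves Lebesgue
    measure.\<close>
  have T_eq: "T = (\<lambda>x. axis j (s $ j + t $ j) + S x)"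
    by (auto simp: T_def S_def fun_eq_iff vec_eq_iff axis_def)
  have [measurable]: "S \<in> borel_measurable borel"
    using S by (rule orthogonal_transformation_measurable)
  have Tm: "T \<in> borel_measurable borel"
    unfolding T_eq by measurable
  have "distr (distr lborel borel S) borel ((+) (axis j (s $ j + t $ j))) = lborel"
    unfolding distr_lborel_orthogonal[OF S] by (rule lborel_distr_plus)
  then have T: "distr lborel borel T = lborel"
    by (subst (asm) distr_distr) (simp_all add: T_eq comp_def)
  let ?K = "\<lambda>x. gauss_density (x - s)" and ?L = "\<lambda>x. gauss_density (x - t)"
  have KT: "gauss_density (T x - s) = gauss_density (x - t)"
    "gauss_density (T x - t) = gauss_density (x - s)" for x
    using out by (auto simp: gauss_density_eq T_def power2_commute intro!: sum.cong)
  have KL: "?K x - ?L x = ?L x * (exp ((s $ j - t $ j) * (2 * x $ j - s $ j - t $ j) / 2) - 1)" for x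
  proof -
    have sum: "(\<Sum>l\<in>UNIV. ((x - v) $ l)\<^sup>2) = (x $ j - v $ j)\<^sup>2 + (\<Sum>l\<in>- {j}. (x $ l - v $ l)\<^sup>2)" for v
      by (subst sum.remove[of UNIV j]) (simp_all add: Compl_eq_Diff_UNIV)
    have "(\<Sum>l\<in>- {j}. (x $ l - s $ l)\<^sup>2) = (\<Sum>l\<in>- {j}. (x $ l - t $ l)\<^sup>2)"
      using out by (intro sum.cong) auto
    then have "?K x = ?L x * exp ((s $ j - t $ j) * (2 * x $ j - s $ j - t $ j) / 2)"
      unfolding gauss_density_eq sum by (simp add: power2_eq_square field_simps flip: exp_add)
    then show ?thesis by (simp add: algebra_simps)
  qed
  \<comment> \<open>With w for \<open>s $ j + t $ j\<close>, the assumption says that w (2 x - w) is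
    positive. The sign of w drops out after multiplication by w times \<open>s $ j - t $ j\<close>,
    which is the difference of the squares of \<open>s $ j\<close> and \<open>t $ j\<close>.\<close>
  have key: "0 \<le> (s $ j - t $ j) * (2 * x - s $ j - t $ j) \<and>
      (\<bar>t $ j\<bar> < \<bar>s $ j\<bar> \<longrightarrow> 0 < (s $ j - t $ j) * (2 * x - s $ j - t $ j))"
    if "\<bar>s $ j + t $ j - x\<bar> < \<bar>x\<bar>" for x
  proof -
    have "(s $ j + t $ j - x)\<^sup>2 < x\<^sup>2"
      using that by (metis abs_le_square_iff not_less)
    then have 1: "0 < (s $ j + t $ j) * (2 * x - s $ j - t $ j)"
      by (simp add: power2_eq_square algebra_simps)
    then have 2: "0 < (s $ j + t $ j)\<^sup>2" by auto
    have 3: "(s $ j + t $ j)\<^sup>2 * ((s $ j - t $ j) * (2 * x - s $ j - t $ j)) =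
        ((s $ j)\<^sup>2 - (t $ j)\<^sup>2) * ((s $ j + t $ j) * (2 * x - s $ j - t $ j))"
      by (simp add: power2_eq_square algebra_simps)
    have "0 \<le> (s $ j)\<^sup>2 - (t $ j)\<^sup>2" using ts by (simp add: abs_le_square_iff)
    then have "0 \<le> (s $ j + t $ j)\<^sup>2 * ((s $ j - t $ j) * (2 * x - s $ j - t $ j))"
      unfolding 3 using 1 by simp
    moreover have "0 < (s $ j + t $ j)\<^sup>2 * ((s $ j - t $ j) * (2 * x - s $ j - t $ j))" if "\<bar>t $ j\<bar> < \<bar>s $ j\<bar>"
    proof -
      have "0 < (s $ j)\<^sup>2 - (t $ j)\<^sup>2" using that by (simp add: abs_le_square_iff flip: not_le)
      then show ?thesis unfolding 3 using 1 by simp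
    qed
    ultimately show ?thesis
      using 2 by (auto simp: zero_le_mult_iff zero_less_mult_iff)
  qed
  have flip: "\<bar>s $ j + t $ j - x $ j\<bar> < \<bar>x $ j\<bar>" if "x \<in> A" "T x \<notin> A" for x
    using upper[of x "T x"] that by (fastforce simp: T_def)
  have TT: "T (T x) = x" for x
    by (simp add: T_def vec_eq_iff)
  have nonneg: "0 \<le> (f x - f (T x)) * (?K x - ?L x)" for x
  proof -
    have half: "0 \<le> ?K y - ?L y" if "y \<in> A" "T y \<notin> A" for y
      unfolding KL using key[OF flip[OF that]] gauss_density_pos[of "y - t"] by simp
    consider "f x = f (T x)" | "x \<in> A" "T x \<notin> A" | "x \<notin> A" "T x \<in> A"
      by (cases "x \<in> A"; cases "T x \<in> A") (auto simp: f_def)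
    then show ?thesis
      using half[of x] half[of "T x"] by cases (auto simp: f_def TT KT)
  qed
  note int = twice_integral_diff_reflection[OF T Tm f f1 integrable_gauss_density integrable_gauss_density KT]
  have eq: "2 * (measure std_normal_vec {z. z + s \<in> A} - measure std_normal_vec {z. z + t \<in> A}) =
      (LINT x|lborel. (f x - f (T x)) * (?K x - ?L x))"
    unfolding measure_std_normal_vec_shift[OF A] using int(1) by (simp add: f_def)
  have ge: "0 \<le> (LINT x|lborel. (f x - f (T x)) * (?K x - ?L x))"
    by (rule Bochner_Integration.integral_nonneg) (rule nonneg)
  show "measure std_normal_vec {z. z + t \<in> A} \<le> measure std_normal_vec {z. z + s \<in> A}"
    using eq ge by simp
  assume strict: "\<bar>t $ j\<bar> < \<bar>s $ j\<bar>" and U: "open U" "x\<^sub>0 \<in> U"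
    "\<And>x. x \<in> U \<Longrightarrow> x \<in> A \<and> (\<chi> l. if l = j then s $ j + t $ j - x $ j else x $ l) \<notin> A"
  have "(LINT x|lborel. (f x - f (T x)) * (?K x - ?L x)) \<noteq> 0"
  proof
    assume "(LINT x|lborel. (f x - f (T x)) * (?K x - ?L x)) = 0"
    then have "AE x in lborel. (f x - f (T x)) * (?K x - ?L x) = 0"
      using integral_nonneg_eq_0_iff_AE[OF int(2)] nonneg by simp
    then have "AE x in lborel. x \<notin> U"
    proof eventually_elim
      case (elim x)
      show ?case
      proof
        assume "x \<in> U"
        then have x: "x \<in> A" "T x \<notin> A" using U(3)[of x] by (simp_all add: T_def)
        then have "0 < ?K x - ?L x"
          unfolding KL using key[OF flip[OF x]] strict gauss_density_pos[of "x - t"] by simp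
        then show False using elim x by (simp add: f_def)
      qed
    qed
    then show False using AE_lborel_not_in_open[of U] U by auto
  qed
  then show "measure std_normal_vec {z. z + t \<in> A} < measure std_normal_vec {z. z + s \<in> A}"
    using eq ge by simp
qed

subsection \<open>Tests based on a monotone homogeneous functional\<close>

text \<open>Treats all exponents at once. Full strict monotonicity can fail for the minimum and the
  maximum; \<open>coordinate_strict\<close> asks only for one point at which lowering coordinate
  \<open>j\<close> from \<open>b\<close> to \<open>a\<close> crosses the level
  \<open>c\<close>.\<close>

locale mean_functional =
  fixes M :: "real ^ 'n \<Rightarrow> real"
  assumes cont: "continuous_on UNIV M"
    and homogeneous: "0 \<le> c \<Longrightarrow> M (c *\<^sub>R x) = c * M x"
    and mono: "(\<And>l. \<bar>x $ l\<bar> \<le> \<bar>y $ l\<bar>) \<Longrightarrow> M x \<le> M y"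
    and one: "M 1 = 1"
    and coordinate_strict: "0 \<le> a \<Longrightarrow> a < c \<Longrightarrow> c < b \<Longrightarrow>
      \<exists>x. x $ j = b \<and> c < M x \<and> M (\<chi> l. if l = j then a else x $ l) < c"
begin

lemma abs_cong: "(\<And>l. \<bar>x $ l\<bar> = \<bar>y $ l\<bar>) \<Longrightarrow> M x = M y"
  by (intro antisym mono) auto

lemma pos:
  assumes "\<And>l. x $ l \<noteq> 0"
  shows "0 < M x"
proof -
  define m where "m = Min (range (\<lambda>l. \<bar>x $ l\<bar>))"
  have "m \<in> range (\<lambda>l. \<bar>x $ l\<bar>)" unfolding m_def by (rule Min_in) auto
  then have m: "0 < m" using assms by auto
  have "M (m *\<^sub>R 1) \<le> M x"
    using m by (intro mono) (auto simp: m_def)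
  then show ?thesis
    using m by (simp add: homogeneous one)
qed

lemma open_gt: "open {x. c < M x}" and open_lt: "open {x. M x < c}" and closed_level: "closed {x. M x = c}"
  using cont by (auto intro!: open_Collect_less closed_Collect_eq)

lemma measurable [measurable]: "M \<in> borel_measurable borel"
  using cont by (rule borel_measurable_continuous_onI)

text \<open>By homogeneity a ray from the origin meets a positive level at most once, so the
  starlike criterion applies.\<close>

lemma negligible_level:
  assumes "0 < c"
  shows "negligible {x. M x = c}"
proof (rule starlike_negligible[where a = 0])
  show "closed {x. M x = c}" by (rule closed_level)
  fix d x assume "0 + d *\<^sub>R x \<in> {x. M x = c}" "0 \<le> d" "0 + x \<in> {x. M x = c}"
  then show "d = 1" using assms by (simp add: homogeneous)
qed

text \<open>\<open>M\<close> is positive off the coordinate hyperplanes, and these are null.\<close>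

lemma measure_le_0: "measure std_normal_vec {z. M z \<le> 0} = 0"
proof -
  have "negligible (\<Union>l. {x :: real ^ 'n. x $ l = 0})"
  proof (rule negligible_Union[of "range (\<lambda>l. {x :: real ^ 'n. x $ l = 0})"])
    fix S assume "S \<in> range (\<lambda>l. {x :: real ^ 'n. x $ l = 0})"
    then obtain l where "S = {x. x \<bullet> axis l 1 = 0}" by (auto simp: inner_axis)
    then show "negligible S"
      using negligible_standard_hyperplane[of "axis l 1 :: real ^ 'n" 0] by (simp add: axis_in_Basis_iff)
  qed auto
  moreover have "{z. M z \<le> 0} \<subseteq> (\<Union>l. {x :: real ^ 'n. x $ l = 0})"
    using pos by (auto simp flip: not_less)
  ultimately have "negligible {z. M z \<le> 0}" by (rule negligible_subset)
  then show ?thesis by (intro measure_std_normal_vec_negligible) measurable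
qed

lemma tail_strict_antimono:
  assumes "0 < c" "c < d"
  shows "measure std_normal_vec {z. d < M z} < measure std_normal_vec {z. c < M z}"
proof -
  interpret prob_space "std_normal_vec :: (real ^ 'n) measure"
    by (rule prob_space_std_normal_vec)
  define U where "U = {x. c < M x} \<inter> {x. M x < d}"
  have "((c + d) / 2) *\<^sub>R 1 \<in> U"
    using assms by (simp add: U_def homogeneous one)
  moreover have "open U" unfolding U_def by (intro open_Int open_gt open_lt)
  ultimately have "0 < prob U" by (intro measure_std_normal_vec_open_pos) auto
  moreover have "prob (U \<union> {z. d < M z}) = prob U + prob {z. d < M z}"
    by (rule finite_measure_Union) (auto simp: U_def)
  moreover have "prob (U \<union> {z. d < M z}) \<le> prob {z. c < M z}"
    using assms by (intro finite_measure_mono) (auto simp: U_def)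
  ultimately show ?thesis by simp
qed

text \<open>The distribution function of \<open>M\<close> vanishes at 0 and has no atoms on the
  nonnegative half-line, so the intermediate value theorem gives existence. Uniqueness is
  \<open>tail_strict_antimono\<close>.\<close>

lemma ex1_crit_val:
  assumes "0 < \<alpha>" "\<alpha> < 1"
  shows "\<exists>!c. 0 < c \<and> measure std_normal_vec {z. c < M z} = \<alpha>"
proof -
  interpret prob_space "std_normal_vec :: (real ^ 'n) measure"
    by (rule prob_space_std_normal_vec)
  define D where "D = distr std_normal_vec borel M"
  interpret D: real_distribution D
    unfolding D_def by (rule real_distribution_distr) measurable
  have meas: "measure D S = prob {z. M z \<in> S}" if "S \<in> sets borel" for S
    unfolding D_def using that by (subst measure_distr) (auto simp: vimage_def)
  have cdf: "cdf D c = prob {z. M z \<le> c}" for c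
    unfolding cdf_def by (subst meas) auto
  have compl: "prob {z. c < M z} = 1 - cdf D c" for c
    unfolding cdf using prob_compl[of "{z. M z \<le> c}"] by (simp add: Compl_eq_Diff_UNIV[symmetric] Collect_neg_eq[symmetric] not_le)
  have "measure D {c} = 0" if "0 \<le> c" for c
  proof (cases "c = 0")
    case True
    have "prob {z. M z = 0} \<le> prob {z. M z \<le> 0}"
      by (intro finite_measure_mono) auto
    then show ?thesis using measure_le_0 True measure_nonneg[of std_normal_vec "{z. M z = 0}"]
      by (subst meas) auto
  next
    case False
    then show ?thesis
      using that by (subst meas) (auto intro!: measure_std_normal_vec_negligible negligible_level)
  qed
  then have cont: "isCont (cdf D) c" if "0 \<le> c" for c
    using that by (simp add: D.isCont_cdf)
  have "eventually (\<lambda>x. 1 - \<alpha> < cdf D x) at_top"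
    using D.cdf_lim_at_top_prob assms by (intro order_tendstoD(1)) auto
  then obtain b where "0 \<le> b" "1 - \<alpha> < cdf D b"
    by (metis eventually_at_top_linorder linorder_linear)
  moreover have "cdf D 0 = 0" by (simp add: cdf measure_le_0)
  ultimately obtain c where c: "0 \<le> c" "c \<le> b" "cdf D c = 1 - \<alpha>"
    using IVT[of "cdf D" 0 "1 - \<alpha>" b] assms cont by auto
  then have "c \<noteq> 0" using \<open>cdf D 0 = 0\<close> assms by auto
  then have "0 < c \<and> prob {z. c < M z} = \<alpha>" using c by (simp add: compl)
  then show ?thesis
    using tail_strict_antimono by (metis less_irrefl linorder_neqE_linordered_idom)
qed

section \<open>The power of the test as a function of the shift\<close>

definition test_power :: "real \<Rightarrow> real ^ 'n \<Rightarrow> real" where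
  "test_power c s = measure std_normal_vec {z. c < M (z + s)}"

lemma test_power_coordinate_mono:
  assumes "\<And>l. l \<noteq> j \<Longrightarrow> s $ l = t $ l" "\<bar>t $ j\<bar> \<le> \<bar>s $ j\<bar>"
  shows "test_power c t \<le> test_power c s"
proof -
  have "M x \<le> M y" if "\<And>l. l \<noteq> j \<Longrightarrow> y $ l = x $ l" "\<bar>x $ j\<bar> \<le> \<bar>y $ j\<bar>" for x y
    by (rule mono) (use that in \<open>metis order_refl\<close>)
  then have "measure std_normal_vec {z. z + t \<in> {x. c < M x}} \<le> measure std_normal_vec {z. z + s \<in> {x. c < M x}}"
    using assms by (intro measure_shift_coordinate_mono[where j = j]) (auto intro: less_le_trans)
  then show ?thesis by (simp add: test_power_def)
qed

lemma test_power_coordinate_strict_mono: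
  assumes out: "\<And>l. l \<noteq> j \<Longrightarrow> s $ l = t $ l" and j: "\<bar>t $ j\<bar> < \<bar>s $ j\<bar>" and c: "0 < c"
  shows "test_power c t < test_power c s"
proof -
  have upper: "M x \<le> M y" if "\<And>l. l \<noteq> j \<Longrightarrow> y $ l = x $ l" "\<bar>x $ j\<bar> \<le> \<bar>y $ j\<bar>" for x y
    by (rule mono) (use that in \<open>metis order_refl\<close>)
  define w where "w = s $ j + t $ j"
  have w: "w \<noteq> 0" using j unfolding w_def by linarith
  define e where "e = min \<bar>w\<bar> c / 2"
  have e: "0 < e" "e < \<bar>w\<bar>" "e \<le> c" using w c by (auto simp: e_def min_def)
  \<comment> \<open>The choice makes \<open>b - a = \<bar>w\<bar>\<close>, so the reflection taking
    \<open>x $ j\<close> to \<open>w - x $ j\<close> sends \<open>sgn w * b\<close> to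
    \<open>- sgn w * a\<close>. The offset \<open>e\<close> puts \<open>c\<close> strictly between
    \<open>a\<close> and \<open>b\<close>.\<close>
  define a b where "a = c - e" and "b = \<bar>w\<bar> + c - e"
  have ab: "0 \<le> a" "a < c" "c < b" using e by (auto simp: a_def b_def)
  obtain x where x: "x $ j = b" "c < M x" "M (\<chi> l. if l = j then a else x $ l) < c"
    using coordinate_strict[OF ab] by blast
  define T where "T x = (\<chi> l. if l = j then s $ j + t $ j - x $ j else x $ l)" for x :: "real ^ 'n"
  have T: "continuous_on UNIV T"
    unfolding T_def
  proof (rule continuous_on_vec_lambda)
    show "continuous_on UNIV (\<lambda>x. if l = j then s $ j + t $ j - x $ j else x $ l)" for l
      by (cases "l = j") (auto intro!: continuous_intros)
  qed
  define U where "U = {x. c < M x \<and> M (T x) < c}"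
  have "open {x. M (T x) < c}"
    by (intro open_Collect_less continuous_on_compose2[OF cont T]) auto
  then have "open U"
    using open_gt[of c] unfolding U_def by (simp add: open_Int Collect_conj_eq)
  define x' where "x' = (\<chi> l. if l = j then sgn w * b else x $ l)"
  have "M x' = M x"
    by (rule abs_cong) (use w x(1) ab in \<open>auto simp: x'_def abs_mult abs_sgn_eq\<close>)
  moreover have "M (T x') = M (\<chi> l. if l = j then a else x $ l)"
  proof (rule abs_cong)
    fix l
    have "\<bar>w - sgn w * b\<bar> = \<bar>a\<bar>"
      using w by (cases "0 < w") (auto simp: a_def b_def)
    then show "\<bar>T x' $ l\<bar> = \<bar>(\<chi> l. if l = j then a else x $ l) $ l\<bar>"
      by (simp add: T_def x'_def w_def)
  qed
  ultimately have "x' \<in> U" using x by (simp add: U_def)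
  have "measure std_normal_vec {z. z + t \<in> {x. c < M x}} < measure std_normal_vec {z. z + s \<in> {x. c < M x}}"
  proof (rule measure_shift_coordinate_strict_mono[where j = j and U = U and x\<^sub>0 = x'])
    show "y \<in> {x. c < M x}"
      if "x \<in> {x. c < M x}" "\<And>l. l \<noteq> j \<Longrightarrow> y $ l = x $ l" "\<bar>x $ j\<bar> \<le> \<bar>y $ j\<bar>" for x y
      using upper[of y x] that by (auto intro: less_le_trans)
    show "x \<in> {x. c < M x} \<and> (\<chi> l. if l = j then s $ j + t $ j - x $ j else x $ l) \<notin> {x. c < M x}" if "x \<in> U" for x
      using that by (simp add: U_def T_def)
  qed (use out j \<open>open U\<close> \<open>x' \<in> U\<close> in auto)
  then show ?thesis by (simp add: test_power_def)
qed

lemma test_power_mono: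
  assumes "\<And>l. \<bar>t $ l\<bar> \<le> \<bar>s $ l\<bar>"
  shows "test_power c t \<le> test_power c s"
proof -
  have "test_power c t \<le> test_power c (\<chi> l. if l \<in> L then s $ l else t $ l)" if "finite L" for L :: "'n set"
    using that
  proof (induction L)
    case empty
    have "(\<chi> l. t $ l) = t" by (simp add: vec_eq_iff)
    then show ?case by simp
  next
    case (insert j L)
    have "test_power c (\<chi> l. if l \<in> L then s $ l else t $ l) \<le> test_power c (\<chi> l. if l \<in> insert j L then s $ l else t $ l)"
      by (rule test_power_coordinate_mono[where j = j]) (use assms insert.hyps in auto)
    then show ?case using insert.IH by simp
  qed
  from this[of UNIV] show ?thesis by simp
qed

lemma test_power_abs_cong: "(\<And>l. \<bar>t $ l\<bar> = \<bar>s $ l\<bar>) \<Longrightarrow> test_power c t = test_power c s"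
  by (intro antisym test_power_mono) auto

lemma test_power_strict_mono:
  assumes le: "\<And>l. \<bar>t $ l\<bar> \<le> \<bar>s $ l\<bar>" and j: "\<bar>t $ j\<bar> < \<bar>s $ j\<bar>" and c: "0 < c"
  shows "test_power c t < test_power c s"
proof -
  define s' where "s' = (\<chi> l. if l = j then s $ j else t $ l)"
  have "test_power c t < test_power c s'"
    by (rule test_power_coordinate_strict_mono[where j = j]) (use j c in \<open>auto simp: s'_def\<close>)
  also have "\<dots> \<le> test_power c s"
    by (rule test_power_mono) (use le in \<open>auto simp: s'_def\<close>)
  finally show ?thesis .
qed

lemma test_power_ray_strict_mono:
  assumes "u \<noteq> 0" "0 \<le> a" "a < b" "0 < c"
  shows "test_power c (a *\<^sub>R u) < test_power c (b *\<^sub>R u)"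
proof -
  obtain j where "u $ j \<noteq> 0" using assms(1) by (auto simp: vec_eq_iff)
  then show ?thesis
    using assms by (intro test_power_strict_mono[where j = j]) (auto simp: abs_mult mult_right_mono)
qed

text \<open>Off the null set \<open>M (z + s) = c\<close> the indicators are eventually constant
  along a convergent sequence of shifts; dominated convergence does the rest.\<close>

lemma continuous_test_power:
  assumes c: "0 < c"
  shows "continuous_on UNIV (test_power c)"
proof -
  interpret prob_space "std_normal_vec :: (real ^ 'n) measure"
    by (rule prob_space_std_normal_vec)
  have eq: "test_power c s = (LINT z|std_normal_vec. indicator {x. c < M x} (z + s))" for s
  proof -
    have "(LINT z|std_normal_vec. indicator {x. c < M x} (z + s)) = (LINT z|std_normal_vec. indicator {z. c < M (z + s)} z :: real)"
      by (intro Bochner_Integration.integral_cong) (auto simp: indicator_def)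
    then show ?thesis by (simp add: test_power_def)
  qed
  have "(\<lambda>n. test_power c (S n)) \<longlonglongrightarrow> test_power c s" if S: "S \<longlonglongrightarrow> s" for S s
    unfolding eq
  proof (rule integral_dominated_convergence[where w = "\<lambda>_. 1"])
    have "negligible ((+) (- s) ` {x. M x = c})"
      using negligible_level[OF c] by (rule negligible_translation)
    moreover have "(+) (- s) ` {x. M x = c} = {z. M (z + s) = c}"
      by (force simp: image_iff algebra_simps)
    ultimately have "measure std_normal_vec {z. M (z + s) = c} = 0"
      by (intro measure_std_normal_vec_negligible) auto
    then have "AE z in std_normal_vec. M (z + s) \<noteq> c"
      by (subst (asm) prob_eq_0) auto
    then show "AE z in std_normal_vec. (\<lambda>n. indicator {x. c < M x} (z + S n)) \<longlonglongrightarrow> (indicator {x. c < M x} (z + s) :: real)"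
    proof eventually_elim
      case (elim z)
      have "(\<lambda>n. z + S n) \<longlonglongrightarrow> z + s" using S by (intro tendsto_intros)
      then have lim: "(\<lambda>n. M (z + S n)) \<longlonglongrightarrow> M (z + s)"
        using cont by (intro continuous_on_tendsto_compose[OF cont]) auto
      have "eventually (\<lambda>n. indicator {x. c < M x} (z + S n) = (indicator {x. c < M x} (z + s) :: real)) sequentially"
      proof (cases "c < M (z + s)")
        case True
        then show ?thesis using order_tendstoD(1)[OF lim True] by (auto elim!: eventually_mono)
      next
        case False
        then have "M (z + s) < c" using elim by simp
        from order_tendstoD(2)[OF lim this] show ?thesis
          using False by (auto elim!: eventually_mono)
      qed
      then show ?case by (rule tendsto_eventually)
    qed
  qed (auto simp: indicator_def)
  then show ?thesis by (auto simp: continuous_on_sequentially comp_def)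
qed

lemma test_power_pair_transfer:
  assumes "\<And>x y. pair_transfer i j x y \<Longrightarrow> M x \<le> M y" and "pair_transfer i j t s"
  shows "test_power c t \<le> test_power c s"
proof -
  have "measure std_normal_vec {z. z + t \<in> {x. c < M x}} \<le> measure std_normal_vec {z. z + s \<in> {x. c < M x}}"
    using assms by (intro measure_shift_pair_transfer[where i = i and j = j]) (auto intro: less_le_trans)
  then show ?thesis by (simp add: test_power_def)
qed

text \<open>Here the sublevel sets of \<open>M\<close> are closed under transfers, so the comparison
  is applied to the complement of the rejection region.\<close>

lemma test_power_pair_transfer':
  assumes "\<And>x y. pair_transfer i j x y \<Longrightarrow> M y \<le> M x" and "pair_transfer i j t s"
  shows "test_power c s \<le> test_power c t"
proof -
  interpret prob_space "std_normal_vec :: (real ^ 'n) measure"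
    by (rule prob_space_std_normal_vec)
  have compl: "test_power c v = 1 - measure std_normal_vec {z. z + v \<in> {x. M x \<le> c}}" for v
    using prob_compl[of "{z. M (z + v) \<le> c}"]
    by (simp add: test_power_def Compl_eq_Diff_UNIV[symmetric] Collect_neg_eq[symmetric] not_le)
  have "measure std_normal_vec {z. z + t \<in> {x. M x \<le> c}} \<le> measure std_normal_vec {z. z + s \<in> {x. M x \<le> c}}"
    using assms by (intro measure_shift_pair_transfer[where i = i and j = j]) (auto intro: order_trans)
  then show ?thesis by (simp add: compl)
qed

end

subsection \<open>The power means\<close>

lemma pmean_MInfty: "pmean (- \<infinity>) x = Min (range (\<lambda>j. \<bar>x $ j\<bar>))"
  and pmean_PInfty: "pmean \<infinity> x = Max (range (\<lambda>j. \<bar>x $ j\<bar>))"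
  and pmean_0: "pmean 0 x = (\<Prod>j\<in>UNIV. \<bar>x $ j\<bar> powr (1 / real CARD('n)))" for x :: "real ^ 'n"
  by (simp_all add: pmean_def)

lemma pmean_pos_real:
  "0 < p \<Longrightarrow> pmean (ereal p) (x :: real ^ 'n) =
    ((1 / real CARD('n)) * (\<Sum>j\<in>UNIV. \<bar>x $ j\<bar> powr p)) powr (1 / p)"
  by (simp add: pmean_def zero_ereal_def)

lemma pmean_neg_real:
  "p < 0 \<Longrightarrow> pmean (ereal p) (x :: real ^ 'n) = (if \<exists>j. x $ j = 0 then 0 else
    ((1 / real CARD('n)) * (\<Sum>j\<in>UNIV. \<bar>x $ j\<bar> powr p)) powr (1 / p))"
  by (simp add: pmean_def zero_ereal_def)

lemma pmean_1 [simp]: "pmean p (1 :: real ^ 'n) = 1"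
  by (simp add: pmean_def)

lemma continuous_on_Max_Min:
  fixes f :: "'i \<Rightarrow> 'a::topological_space \<Rightarrow> real"
  assumes "finite I" "I \<noteq> {}" "\<And>i. i \<in> I \<Longrightarrow> continuous_on S (f i)"
  shows "continuous_on S (\<lambda>x. Max ((\<lambda>i. f i x) ` I))" and "continuous_on S (\<lambda>x. Min ((\<lambda>i. f i x) ` I))"
  using assms by (induction I rule: finite_ne_induct) (auto intro!: continuous_intros)

lemma prod_const_powr_card: "0 \<le> c \<Longrightarrow> (\<Prod>j\<in>(UNIV :: 'n::finite set). c powr (1 / real CARD('n))) = c"
  by (cases "c = 0") (simp_all add: powr_powr flip: powr_realpow)

lemma ereal_exponent_cases [case_names MInfty PInfty zero pos neg]:
  assumes "p = - \<infinity> \<Longrightarrow> P" "p = \<infinity> \<Longrightarrow> P" "p = 0 \<Longrightarrow> P"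
    "\<And>r. p = ereal r \<Longrightarrow> 0 < r \<Longrightarrow> P" "\<And>r. p = ereal r \<Longrightarrow> r < 0 \<Longrightarrow> P"
  shows P
proof (cases p)
  case (real r)
  then show ?thesis using assms(3-5) by (cases r "0::real" rule: linorder_cases) (auto simp: zero_ereal_def)
qed (use assms in auto)

lemma pmean_mono:
  fixes x y :: "real ^ 'n"
  assumes le: "\<And>l. \<bar>x $ l\<bar> \<le> \<bar>y $ l\<bar>"
  shows "pmean p x \<le> pmean p y"
proof (cases p rule: ereal_exponent_cases)
  case MInfty
  have "Min (range (\<lambda>j. \<bar>x $ j\<bar>)) \<le> \<bar>y $ l\<bar>" for l
    using le[of l] by (intro order_trans[OF Min_le]) auto
  then show ?thesis unfolding MInfty pmean_MInfty by (intro Min.boundedI) auto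
next
  case PInfty
  have "\<bar>x $ l\<bar> \<le> Max (range (\<lambda>j. \<bar>y $ j\<bar>))" for l
    using le[of l] by (rule order_trans) (auto intro!: Max_ge)
  then show ?thesis unfolding PInfty pmean_PInfty by (intro Max.boundedI) auto
next
  case zero
  show ?thesis unfolding zero pmean_0 using le by (intro prod_mono) (auto intro!: powr_mono2)
next
  case (pos r)
  then show ?thesis unfolding pos(1) pmean_pos_real[OF pos(2)]
    using le by (intro powr_mono2 mult_left_mono sum_mono) (auto intro!: divide_nonneg_nonneg sum_nonneg)
next
  case (neg r)
  show ?thesis
  proof (cases "\<exists>j. x $ j = 0")
    case True
    then show ?thesis unfolding neg(1) pmean_neg_real[OF neg(2)] by simp
  next
    case False
    then have nz: "0 < \<bar>x $ j\<bar>" "0 < \<bar>y $ j\<bar>" for j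
      using le[of j] by (auto simp: zero_less_abs_iff[symmetric] simp del: zero_less_abs_iff intro: less_le_trans)
    then have ex: "\<not> (\<exists>j. y $ j = 0)" by auto
    have "0 < (\<Sum>j\<in>UNIV. \<bar>y $ j\<bar> powr r)"
      using nz by (intro sum_pos) auto
    then show ?thesis unfolding neg(1) pmean_neg_real[OF neg(2)] if_not_P[OF False] if_not_P[OF ex]
      using le nz neg(2) by (intro powr_mono2' mult_left_mono sum_mono) auto
  qed
qed

lemma pmean_nonneg: "0 \<le> pmean p (x :: real ^ 'n)"
proof -
  have "0 \<le> pmean p (0 :: real ^ 'n)" by (simp add: pmean_def)
  also have "\<dots> \<le> pmean p x" by (rule pmean_mono) simp
  finally show ?thesis .
qed

lemma pmean_scaleR:
  fixes x :: "real ^ 'n"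
  assumes "0 \<le> c"
  shows "pmean p (c *\<^sub>R x) = c * pmean p x"
proof (cases "c = 0")
  case True
  then show ?thesis by (simp add: pmean_def)
next
  case False
  then have c: "0 < c" using assms by simp
  have mono: "mono ((*) c)" using c by (intro monoI) simp
  show ?thesis
  proof (cases p rule: ereal_exponent_cases)
    case MInfty
    then show ?thesis
      using mono_Min_commute[OF mono, of "range (\<lambda>j. \<bar>x $ j\<bar>)"] c
      by (simp add: pmean_MInfty abs_mult image_image)
  next
    case PInfty
    then show ?thesis
      using mono_Max_commute[OF mono, of "range (\<lambda>j. \<bar>x $ j\<bar>)"] c
      by (simp add: pmean_PInfty abs_mult image_image)
  next
    case zero
    then show ?thesis
      using c by (simp add: pmean_0 abs_mult powr_mult prod.distrib prod_const_powr_card del: prod_constant)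
  next
    case (pos r)
    have "(\<Sum>j\<in>UNIV. \<bar>(c *\<^sub>R x) $ j\<bar> powr r) = c powr r * (\<Sum>j\<in>UNIV. \<bar>x $ j\<bar> powr r)"
      using c by (simp add: abs_mult powr_mult sum_distrib_left)
    then show ?thesis
      using c pos by (simp add: pmean_pos_real powr_mult powr_divide powr_powr sum_nonneg)
  next
    case (neg r)
    have "(\<Sum>j\<in>UNIV. \<bar>(c *\<^sub>R x) $ j\<bar> powr r) = c powr r * (\<Sum>j\<in>UNIV. \<bar>x $ j\<bar> powr r)"
      using c by (simp add: abs_mult powr_mult sum_distrib_left)
    then show ?thesis
      using c neg by (simp add: pmean_neg_real powr_mult powr_divide powr_powr sum_nonneg)
  qed
qed

text \<open>The delicate case is a negative exponent at a point with a zero coordinate, where the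
  mean is 0 by convention and has to be squeezed to 0 nearby.\<close>

lemma continuous_on_pmean: "continuous_on UNIV (pmean p :: real ^ 'n \<Rightarrow> real)"
proof (cases p rule: ereal_exponent_cases)
  case MInfty
  show ?thesis
    unfolding MInfty pmean_MInfty[abs_def] by (auto intro!: continuous_on_Max_Min continuous_intros)
next
  case PInfty
  show ?thesis
    unfolding PInfty pmean_PInfty[abs_def] by (auto intro!: continuous_on_Max_Min continuous_intros)
next
  case zero
  show ?thesis
    unfolding zero pmean_0[abs_def] by (auto intro!: continuous_intros continuous_on_powr')
next
  case (pos r)
  then have "(pmean p :: real ^ 'n \<Rightarrow> real) =
      (\<lambda>x. ((1 / real CARD('n)) * (\<Sum>j\<in>UNIV. \<bar>x $ j\<bar> powr r)) powr (1 / r))"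
    by (simp add: fun_eq_iff pmean_pos_real)
  then show ?thesis
    using pos(2) by (auto simp: sum_nonneg intro!: continuous_intros continuous_on_powr')
next
  case (neg r)
  let ?M = "\<lambda>y :: real ^ 'n. ((1 / real CARD('n)) * (\<Sum>j\<in>UNIV. \<bar>y $ j\<bar> powr r)) powr (1 / r)"
  have "(pmean (ereal r) \<longlongrightarrow> pmean (ereal r) x) (at x)" for x :: "real ^ 'n"
  proof (cases "\<exists>j. x $ j = 0")
    case True
    then obtain j where j: "x $ j = 0" by auto
    \<comment> \<open>Keeping only the term of \<open>j\<close> lowers the sum and, the outer
      exponent being negative, raises the mean.\<close>
    have bound: "pmean (ereal r) y \<le> (1 / real CARD('n)) powr (1 / r) * \<bar>y $ j\<bar>" for y :: "real ^ 'n"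
    proof (cases "\<exists>j. y $ j = 0")
      case True
      then show ?thesis using neg by (simp add: pmean_neg_real)
    next
      case False
      have "\<bar>y $ j\<bar> powr r \<le> (\<Sum>j\<in>UNIV. \<bar>y $ j\<bar> powr r)"
        by (rule member_le_sum) auto
      then have "?M y \<le> (1 / real CARD('n) * \<bar>y $ j\<bar> powr r) powr (1 / r)"
        using neg False by (intro powr_mono2' mult_left_mono) auto
      also have "\<dots> = (1 / real CARD('n)) powr (1 / r) * \<bar>y $ j\<bar>"
        using neg by (simp add: powr_divide powr_powr)
      finally show ?thesis using neg False by (simp add: pmean_neg_real)
    qed
    have "((\<lambda>y. (1 / real CARD('n)) powr (1 / r) * \<bar>y $ j\<bar>) \<longlongrightarrow> (1 / real CARD('n)) powr (1 / r) * \<bar>x $ j\<bar>) (at x)"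
      by (intro tendsto_intros)
    then have "((\<lambda>y. (1 / real CARD('n)) powr (1 / r) * \<bar>y $ j\<bar>) \<longlongrightarrow> 0) (at x)"
      by (simp add: j)
    then have "(pmean (ereal r) \<longlongrightarrow> 0) (at x)"
      by (rule tendsto_sandwich[OF _ _ tendsto_const, rotated -1]) (simp_all add: pmean_nonneg bound)
    then show ?thesis using True neg by (simp add: pmean_neg_real)
  next
    case False
    have "eventually (\<lambda>y. y $ j \<noteq> 0) (at x)" for j
      using False by (intro tendsto_imp_eventually_ne[where c = "x $ j"] tendsto_intros) auto
    then have "eventually (\<lambda>y. \<forall>j. y $ j \<noteq> 0) (at x)"
      by (rule eventually_all_finite)
    then have ev: "eventually (\<lambda>y. ?M y = pmean (ereal r) y) (at x)"
      by eventually_elim (use neg in \<open>auto simp: pmean_neg_real\<close>)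
    have "0 < (\<Sum>j\<in>UNIV. \<bar>x $ j\<bar> powr r)"
      using False by (intro sum_pos) auto
    then have "(?M \<longlongrightarrow> ?M x) (at x)"
      using False by (intro tendsto_intros) auto
    then show ?thesis
      using False neg by (subst (asm) tendsto_cong[OF ev]) (simp add: pmean_neg_real)
  qed
  then show ?thesis using neg by (simp add: continuous_on_def)
qed

text \<open>If \<open>p\<close> is not positive, a zero coordinate of \<open>y\<close> is also one
  of \<open>x\<close> and makes both means vanish. At the infinite exponents a single coordinate
  need not influence the mean. Both situations are excluded.\<close>

lemma pmean_strict_mono:
  fixes x y :: "real ^ 'n"
  assumes le: "\<And>l. \<bar>x $ l\<bar> \<le> \<bar>y $ l\<bar>" and j: "\<bar>x $ j\<bar> < \<bar>y $ j\<bar>"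
    and y: "\<And>l. y $ l \<noteq> 0" and p: "\<bar>p\<bar> \<noteq> \<infinity>"
  shows "pmean p x < pmean p y"
proof (cases p rule: ereal_exponent_cases)
  case zero
  have "(\<Prod>j\<in>UNIV. \<bar>x $ j\<bar> powr (1 / real CARD('n))) < (\<Prod>j\<in>UNIV. \<bar>y $ j\<bar> powr (1 / real CARD('n)))"
    using le j y by (intro prod_mono_strict[of j]) (auto intro!: powr_mono2 powr_less_mono2)
  then show ?thesis unfolding zero pmean_0 .
next
  case (pos r)
  have "(\<Sum>j\<in>UNIV. \<bar>x $ j\<bar> powr r) < (\<Sum>j\<in>UNIV. \<bar>y $ j\<bar> powr r)"
    using le j pos by (intro sum_strict_mono_ex1) (auto intro!: powr_mono2 powr_less_mono2)
  then show ?thesis unfolding pos(1) pmean_pos_real[OF pos(2)]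
    using pos by (intro powr_less_mono2 mult_strict_left_mono) (auto intro!: divide_nonneg_nonneg sum_nonneg)
next
  case (neg r)
  have y0: "0 < (\<Sum>j\<in>UNIV. \<bar>y $ j\<bar> powr r)" using y by (intro sum_pos) auto
  show ?thesis
  proof (cases "\<exists>j. x $ j = 0")
    case True
    have "0 < ((1 / real CARD('n)) * (\<Sum>j\<in>UNIV. \<bar>y $ j\<bar> powr r)) powr (1 / r)"
      using y0 by simp
    then show ?thesis unfolding neg(1) pmean_neg_real[OF neg(2)] using True y by simp
  next
    case False
    have ex: "\<not> (\<exists>j. y $ j = 0)" using y by auto
    have "(\<Sum>j\<in>UNIV. \<bar>y $ j\<bar> powr r) < (\<Sum>j\<in>UNIV. \<bar>x $ j\<bar> powr r)"
      using le j neg False by (intro sum_strict_mono_ex1) (auto intro!: powr_mono2' powr_less_mono2_neg)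
    then show ?thesis unfolding neg(1) pmean_neg_real[OF neg(2)] if_not_P[OF False] if_not_P[OF ex]
      using neg y0 by (intro powr_less_mono2_neg mult_strict_left_mono) auto
  qed
qed (use p in auto)

lemma mean_functional_pmean: "mean_functional (pmean p :: real ^ 'n \<Rightarrow> real)"
proof
  show "continuous_on UNIV (pmean p :: real ^ 'n \<Rightarrow> real)" by (rule continuous_on_pmean)
  show "pmean p (c *\<^sub>R x) = c * pmean p x" if "0 \<le> c" for c and x :: "real ^ 'n"
    using that by (rule pmean_scaleR)
  show "pmean p x \<le> pmean p y" if "\<And>l. \<bar>x $ l\<bar> \<le> \<bar>y $ l\<bar>" for x y :: "real ^ 'n"
    using that by (rule pmean_mono)
  show "pmean p (1 :: real ^ 'n) = 1" by simp
  fix a b c :: real and j :: 'n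
  assume abc: "0 \<le> a" "a < c" "c < b"
  have const: "pmean p ((\<chi> l. d) :: real ^ 'n) = d" if "0 \<le> d" for d and p :: ereal
  proof -
    have "((\<chi> l. d) :: real ^ 'n) = d *\<^sub>R (1 :: real ^ 'n)" by (simp add: vec_eq_iff)
    then show ?thesis using that by (simp add: pmean_scaleR)
  qed
  \<comment> \<open>The coordinates other than \<open>j\<close> are set to \<open>a\<close> for the
    maximum, to \<open>b\<close> for the minimum, and to \<open>c\<close> for finite exponents. In
    the last case the constant vector \<open>c\<close> separates the two vectors.\<close>
  consider "p = \<infinity>" | "p = - \<infinity>" | "\<bar>p\<bar> \<noteq> \<infinity>" by (cases p) auto
  then show "\<exists>x :: real ^ 'n. x $ j = b \<and> c < pmean p x \<and> pmean p (\<chi> l. if l = j then a else x $ l) < c"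
  proof cases
    case 1
    define x where "x = (\<chi> l. if l = j then b else a)"
    have "b \<le> pmean p x"
      unfolding 1 pmean_PInfty using abc by (intro Max_ge) (auto simp: x_def intro!: rev_image_eqI[of j])
    then have "c < pmean p x" using abc by simp
    moreover have "(\<chi> l. if l = j then a else x $ l) = (\<chi> l. a)" by (simp add: x_def vec_eq_iff)
    ultimately show ?thesis
      using abc const[of a p] by (intro exI[of _ x]) (simp add: x_def)
  next
    case 2
    define x where "x = ((\<chi> l. b) :: real ^ 'n)"
    have "pmean p (\<chi> l. if l = j then a else x $ l) \<le> a"
      unfolding 2 pmean_MInfty using abc by (intro Min_le) (auto intro!: rev_image_eqI[of j])
    then show ?thesis
      using abc const[of b p] by (intro exI[of _ x]) (simp add: x_def)
  next
    case 3
    define x where "x = ((\<chi> l. if l = j then b else c) :: real ^ 'n)"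
    have "pmean p ((\<chi> l. c) :: real ^ 'n) < pmean p x"
      using abc 3 by (intro pmean_strict_mono[where j = j]) (auto simp: x_def)
    moreover have "pmean p (\<chi> l. if l = j then a else x $ l) < pmean p ((\<chi> l. c) :: real ^ 'n)"
      using abc 3 by (intro pmean_strict_mono[where j = j]) (auto simp: x_def)
    ultimately show ?thesis
      using abc const[of c p] by (intro exI[of _ x]) (auto simp: x_def)
  qed
qed

subsection \<open>Power means under transfers\<close>

text \<open>The assumption is the sign of the second derivative; a negative \<open>\<sigma>\<close>
  lets the concave exponents be treated as convex ones.\<close>

lemma convex_on_scaled_powr:
  assumes "0 \<le> \<sigma> * q * (q - 1)"
  shows "convex_on {0<..} (\<lambda>x::real. \<sigma> * x powr q)"
proof (rule convex_on_realI)
  show "connected {0::real<..}" by simp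
  show "((\<lambda>x. \<sigma> * x powr q) has_real_derivative \<sigma> * (q * x powr (q - 1))) (at x)" if "x \<in> {0<..}" for x
    using that by (intro DERIV_cmult has_real_derivative_powr) auto
  fix x y :: real
  assume xy: "x \<in> {0<..}" "y \<in> {0<..}" "x \<le> y"
  show "\<sigma> * (q * x powr (q - 1)) \<le> \<sigma> * (q * y powr (q - 1))"
  proof (cases q "1 :: real" rule: linorder_cases)
    case less
    then have "\<sigma> * q \<le> 0" using assms by (auto simp: zero_le_mult_iff)
    moreover have "y powr (q - 1) \<le> x powr (q - 1)" using xy less by (intro powr_mono2') auto
    ultimately show ?thesis by (simp add: mult_left_mono_neg flip: mult.assoc)
  next
    case greater
    then have "0 \<le> \<sigma> * q" using assms by (auto simp: zero_le_mult_iff)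
    moreover have "x powr (q - 1) \<le> y powr (q - 1)" using xy greater by (intro powr_mono2) auto
    ultimately show ?thesis by (simp add: mult_left_mono flip: mult.assoc)
  qed (use xy in auto)
qed

lemma powr_transfer_pos:
  fixes x y z w :: real
  assumes \<sigma>: "0 \<le> \<sigma> * q * (q - 1)" and "0 < z" "0 < w" "x + y = z + w" "z * w \<le> x * y"
  shows "\<sigma> * (x powr q + y powr q) \<le> \<sigma> * (z powr q + w powr q)"
  using convex_on_transfer'[OF convex_on_scaled_powr[OF \<sigma>], of z w x y] assms
  by (simp add: distrib_left)

text \<open>Extends the inequality to zero arguments. Adding \<open>e > 0\<close> to all four
  numbers preserves both the equality of sums and the order of products, and for
  \<open>q > 0\<close> the limit at 0 is harmless.\<close>

lemma powr_transfer:
  fixes x y z w :: real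
  assumes \<sigma>: "0 \<le> \<sigma> * (q - 1)" and q: "0 < q"
    and nn: "0 \<le> x" "0 \<le> y" "0 \<le> z" "0 \<le> w" and "x + y = z + w" "z * w \<le> x * y"
  shows "\<sigma> * (x powr q + y powr q) \<le> \<sigma> * (z powr q + w powr q)"
proof (rule tendsto_le)
  have lim: "((\<lambda>e. (v + e) powr q) \<longlongrightarrow> v powr q) (at_right 0)" if "0 \<le> v" for v
  proof -
    have "((\<lambda>e. (v + e) powr q) \<longlongrightarrow> (v + 0) powr q) (at_right 0)"
      using q that by (intro tendsto_powr' tendsto_intros) (auto simp: eventually_at_right_less intro!: eventually_mono[OF eventually_at_right_less])
    then show ?thesis by simp
  qed
  have lim2: "((\<lambda>e. \<sigma> * ((u + e) powr q + (v + e) powr q)) \<longlongrightarrow> \<sigma> * (u powr q + v powr q)) (at_right 0)"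
    if "0 \<le> u" "0 \<le> v" for u v
    using that by (intro tendsto_mult tendsto_const tendsto_add lim)
  show "((\<lambda>e. \<sigma> * ((x + e) powr q + (y + e) powr q)) \<longlongrightarrow> \<sigma> * (x powr q + y powr q)) (at_right 0)"
    using nn by (intro lim2)
  show "((\<lambda>e. \<sigma> * ((z + e) powr q + (w + e) powr q)) \<longlongrightarrow> \<sigma> * (z powr q + w powr q)) (at_right 0)"
    using nn by (intro lim2)
  have \<sigma>': "0 \<le> \<sigma> * q * (q - 1)"
    using \<sigma> q by (metis less_eq_real_def mult.assoc mult.left_commute zero_le_mult_iff)
  have "\<sigma> * ((x + e) powr q + (y + e) powr q) \<le> \<sigma> * ((z + e) powr q + (w + e) powr q)" if "0 < e" for e
  proof (rule powr_transfer_pos[OF \<sigma>'])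
    have "e * x + e * y = e * z + e * w"
      using \<open>x + y = z + w\<close> by (metis distrib_left)
    then show "(z + e) * (w + e) \<le> (x + e) * (y + e)"
      using \<open>z * w \<le> x * y\<close> by (simp add: algebra_simps)
  qed (use assms that in auto)
  then show "\<forall>\<^sub>F e in at_right 0. \<sigma> * ((x + e) powr q + (y + e) powr q) \<le> \<sigma> * ((z + e) powr q + (w + e) powr q)"
    by (intro eventually_mono[OF eventually_at_right_less]) auto
qed simp

lemma abs_powr_eq: "\<bar>x\<bar> powr r = (x\<^sup>2) powr (r / 2)" for x r :: real
proof -
  have sq: "x\<^sup>2 = \<bar>x\<bar> powr 2" by (cases "x = 0") (simp_all add: powr_numeral)
  show ?thesis unfolding sq powr_powr by simp
qed

lemma pair_transfer_squares:
  assumes "pair_transfer i j x y"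
  shows "i \<noteq> j" "\<And>l. l \<noteq> i \<Longrightarrow> l \<noteq> j \<Longrightarrow> y $ l = x $ l"
    "(y $ i)\<^sup>2 + (y $ j)\<^sup>2 = (x $ i)\<^sup>2 + (x $ j)\<^sup>2" "(x $ i)\<^sup>2 * (x $ j)\<^sup>2 \<le> (y $ i)\<^sup>2 * (y $ j)\<^sup>2"
    "\<bar>x $ i * x $ j\<bar> \<le> \<bar>y $ i * y $ j\<bar>"
  using assms by (auto simp: pair_transfer_def abs_le_square_iff power_mult_distrib)

text \<open>The transfer inequality for the power \<open>r / 2\<close>, applied to squares:
  \<open>\<sigma> = -1\<close> serves \<open>0 < r \<le> 2\<close>, and \<open>\<sigma> = 1\<close>
  serves \<open>r \<ge> 2\<close> and \<open>r < 0\<close>. For negative \<open>r\<close> zero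
  coordinates are ruled out because \<open>0 powr r = 0\<close> destroys convexity.\<close>

lemma pair_transfer_sum_powr:
  fixes x y :: "real ^ 'n"
  assumes tr: "pair_transfer i j x y"
    and q: "0 < r \<and> 0 \<le> \<sigma> * (r - 2) \<or> r < 0 \<and> 0 \<le> \<sigma> \<and> (\<forall>l. x $ l \<noteq> 0)"
  shows "\<sigma> * (\<Sum>l\<in>UNIV. \<bar>y $ l\<bar> powr r) \<le> \<sigma> * (\<Sum>l\<in>UNIV. \<bar>x $ l\<bar> powr r)"
proof -
  note sq = pair_transfer_squares[OF tr]
  have "\<sigma> * (((y $ i)\<^sup>2) powr (r / 2) + ((y $ j)\<^sup>2) powr (r / 2)) \<le>
      \<sigma> * (((x $ i)\<^sup>2) powr (r / 2) + ((x $ j)\<^sup>2) powr (r / 2))"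
    using q
  proof (elim disjE conjE)
    assume "0 < r" "0 \<le> \<sigma> * (r - 2)"
    then show ?thesis using sq by (intro powr_transfer) (auto simp: zero_le_mult_iff)
  next
    assume "r < 0" "0 \<le> \<sigma>" "\<forall>l. x $ l \<noteq> 0"
    moreover from this have "0 \<le> \<sigma> * (r / 2 * (r / 2 - 1))"
      by (intro mult_nonneg_nonneg mult_nonpos_nonpos) auto
    ultimately show ?thesis using sq by (intro powr_transfer_pos) (auto simp: mult.assoc)
  qed
  then have "\<sigma> * (\<bar>y $ i\<bar> powr r + \<bar>y $ j\<bar> powr r) \<le> \<sigma> * (\<bar>x $ i\<bar> powr r + \<bar>x $ j\<bar> powr r)"
    by (simp add: abs_powr_eq)
  moreover have "(\<Sum>l\<in>- {i, j}. \<bar>y $ l\<bar> powr r) = (\<Sum>l\<in>- {i, j}. \<bar>x $ l\<bar> powr r)"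
    using sq by (intro sum.cong) auto
  ultimately show ?thesis
    by (simp add: sum_split_pair[OF sq(1)] distrib_left)
qed

lemma pair_transfer_extremes:
  assumes "pair_transfer i j x y"
  shows "min \<bar>x $ i\<bar> \<bar>x $ j\<bar> \<le> \<bar>y $ i\<bar>" "min \<bar>x $ i\<bar> \<bar>x $ j\<bar> \<le> \<bar>y $ j\<bar>"
    "\<bar>y $ i\<bar> \<le> max \<bar>x $ i\<bar> \<bar>x $ j\<bar>" "\<bar>y $ j\<bar> \<le> max \<bar>x $ i\<bar> \<bar>x $ j\<bar>"
  using transfer_order[OF pair_transfer_squares(3,4)[OF assms]]
  by (auto simp: min_le_iff_disj le_max_iff_disj abs_le_square_iff)

text \<open>For \<open>0 < p \<le> 2\<close> the power \<open>p / 2\<close> is concave. For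
  \<open>p < 0\<close> it is convex, but the outer exponent \<open>1 / p\<close> reverses the order.
  For \<open>p = 0\<close> the product itself grows, and at minus infinity the smaller coordinate
  grows.\<close>

lemma pmean_pair_transfer_le:
  fixes x y :: "real ^ 'n"
  assumes tr: "pair_transfer i j x y" and p: "p \<le> 2"
  shows "pmean p x \<le> pmean p y"
proof (cases p rule: ereal_exponent_cases)
  case MInfty
  have "Min (range (\<lambda>j. \<bar>x $ j\<bar>)) \<le> \<bar>x $ l\<bar>" for l by (rule Min_le) auto
  note min_le = this
  have m: "Min (range (\<lambda>j. \<bar>x $ j\<bar>)) \<le> min \<bar>x $ i\<bar> \<bar>x $ j\<bar>" by (intro min.boundedI min_le)
  have "Min (range (\<lambda>j. \<bar>x $ j\<bar>)) \<le> \<bar>y $ l\<bar>" for l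
  proof (cases "l = i \<or> l = j")
    case True
    then show ?thesis
      using order_trans[OF m pair_transfer_extremes(1)[OF tr]] order_trans[OF m pair_transfer_extremes(2)[OF tr]]
      by blast
  next
    case False
    then show ?thesis using min_le[of l] pair_transfer_squares(2)[OF tr, of l] by simp
  qed
  then show ?thesis unfolding MInfty pmean_MInfty by (intro Min.boundedI) auto
next
  case zero
  note sq = pair_transfer_squares[OF tr]
  have split: "(\<Prod>l\<in>UNIV. g l) = (g i * g j) * (\<Prod>l\<in>- {i, j}. g l)" for g :: "'n \<Rightarrow> real"
    using prod.subset_diff[of "{i, j}" UNIV g] sq(1) by (simp add: Compl_eq_Diff_UNIV mult.commute)
  have "(\<Prod>l\<in>- {i, j}. \<bar>y $ l\<bar> powr (1 / real CARD('n))) = (\<Prod>l\<in>- {i, j}. \<bar>x $ l\<bar> powr (1 / real CARD('n)))"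
    using sq by (intro prod.cong) auto
  moreover have "\<bar>x $ i * x $ j\<bar> powr (1 / real CARD('n)) \<le> \<bar>y $ i * y $ j\<bar> powr (1 / real CARD('n))"
    using sq(5) by (intro powr_mono2) auto
  ultimately show ?thesis unfolding zero pmean_0 split
    by (simp add: abs_mult powr_mult mult_right_mono prod_nonneg)
next
  case (pos r)
  have "-1 * (\<Sum>l\<in>UNIV. \<bar>y $ l\<bar> powr r) \<le> -1 * (\<Sum>l\<in>UNIV. \<bar>x $ l\<bar> powr r)"
    using pos p by (intro pair_transfer_sum_powr[OF tr]) auto
  then show ?thesis unfolding pos(1) pmean_pos_real[OF pos(2)]
    using pos(2) by (intro powr_mono2 mult_left_mono) (auto intro!: divide_nonneg_nonneg sum_nonneg)
next
  case (neg r)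
  show ?thesis
  proof (cases "\<exists>j. x $ j = 0")
    case True
    then show ?thesis unfolding neg(1) pmean_neg_real[OF neg(2)] by simp
  next
    case False
    note sq = pair_transfer_squares[OF tr]
    \<comment> \<open>A transfer cannot create a zero coordinate, since the product of the two does
      not fall.\<close>
    have "0 < (x $ i)\<^sup>2 * (x $ j)\<^sup>2" using False by simp
    then have "0 < (y $ i)\<^sup>2 * (y $ j)\<^sup>2" using sq(4) by simp
    then have ij: "y $ i \<noteq> 0" "y $ j \<noteq> 0" by auto
    have y: "y $ l \<noteq> 0" for l
      using ij sq(2)[of l] False by (cases "l = i"; cases "l = j") auto
    then have ex: "\<not> (\<exists>j. y $ j = 0)" by auto
    have "1 * (\<Sum>l\<in>UNIV. \<bar>y $ l\<bar> powr r) \<le> 1 * (\<Sum>l\<in>UNIV. \<bar>x $ l\<bar> powr r)"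
      using neg False by (intro pair_transfer_sum_powr[OF tr]) auto
    moreover have "0 < (\<Sum>j\<in>UNIV. \<bar>y $ j\<bar> powr r)"
      using y by (intro sum_pos) auto
    ultimately show ?thesis unfolding neg(1) pmean_neg_real[OF neg(2)] if_not_P[OF False] if_not_P[OF ex]
      using neg(2) by (intro powr_mono2' mult_left_mono) auto
  qed
qed (use p in simp)

lemma pmean_pair_transfer_ge:
  fixes x y :: "real ^ 'n"
  assumes tr: "pair_transfer i j x y" and p: "2 \<le> p"
  shows "pmean p y \<le> pmean p x"
proof (cases p rule: ereal_exponent_cases)
  case PInfty
  have "\<bar>x $ l\<bar> \<le> Max (range (\<lambda>j. \<bar>x $ j\<bar>))" for l by (rule Max_ge) auto
  note le_max = this
  have m: "max \<bar>x $ i\<bar> \<bar>x $ j\<bar> \<le> Max (range (\<lambda>j. \<bar>x $ j\<bar>))" by (intro max.boundedI le_max)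
  have "\<bar>y $ l\<bar> \<le> Max (range (\<lambda>j. \<bar>x $ j\<bar>))" for l
  proof (cases "l = i \<or> l = j")
    case True
    then show ?thesis
      using order_trans[OF pair_transfer_extremes(3)[OF tr] m] order_trans[OF pair_transfer_extremes(4)[OF tr] m]
      by blast
  next
    case False
    then show ?thesis using le_max[of l] pair_transfer_squares(2)[OF tr, of l] by simp
  qed
  then show ?thesis unfolding PInfty pmean_PInfty by (intro Max.boundedI) auto
next
  case (pos r)
  have "1 * (\<Sum>l\<in>UNIV. \<bar>y $ l\<bar> powr r) \<le> 1 * (\<Sum>l\<in>UNIV. \<bar>x $ l\<bar> powr r)"
    using pos p by (intro pair_transfer_sum_powr[OF tr]) auto
  then show ?thesis unfolding pos(1) pmean_pos_real[OF pos(2)]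
    using pos(2) by (intro powr_mono2 mult_left_mono) (auto intro!: divide_nonneg_nonneg sum_nonneg)
qed (use p in auto)

subsection \<open>Majorization\<close>

text \<open>
  Moving \<open>d\<close> from \<open>p\<close> to \<open>q\<close>, where \<open>q\<close> is the first index with \<open>a q < b q\<close> and \<open>p\<close> the last index before
  it with \<open>b p < a p\<close>, keeps \<open>a\<close> sorted and makes it agree with \<open>b\<close> at one more place.
\<close>

lemma transfer_chain:
  fixes a b :: "nat \<Rightarrow> real" and G :: "(nat \<Rightarrow> real) \<Rightarrow> real"
  assumes ext: "\<And>a b. (\<And>i. i < k \<Longrightarrow> a i = b i) \<Longrightarrow> G a = G b"
    and transfer: "\<And>a p q d. p < k \<Longrightarrow> q < k \<Longrightarrow> p \<noteq> q \<Longrightarrow> (\<And>i. i < k \<Longrightarrow> 0 \<le> a i) \<Longrightarrow> 0 \<le> a p - d \<Longrightarrow> 0 \<le> d \<Longrightarrow>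
      d \<le> a p - a q \<Longrightarrow> G a \<le> G (a(p := a p - d, q := a q + d))"
    and "\<And>i. i < k \<Longrightarrow> 0 \<le> a i" and b0: "\<And>i. i < k \<Longrightarrow> 0 \<le> b i"
    and "\<And>i j. i \<le> j \<Longrightarrow> j < k \<Longrightarrow> a j \<le> a i" and b: "\<And>i j. i \<le> j \<Longrightarrow> j < k \<Longrightarrow> b j \<le> b i"
    and "\<And>r. r \<le> k \<Longrightarrow> (\<Sum>i<r. b i) \<le> (\<Sum>i<r. a i)" and "(\<Sum>i<k. b i) = (\<Sum>i<k. a i)"
  shows "G a \<le> G b"
  using assms(3,5,7,8)
\<comment> \<open>Induction on the number of places where \<open>a\<close> and \<open>b\<close>
  differ.\<close>
proof (induction "card {i. i < k \<and> a i \<noteq> b i}" arbitrary: a rule: less_induct)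
  case less
  note a0 = less.prems(1) and a = less.prems(2) and sums = less.prems(3) and total = less.prems(4)
  show ?case
  proof (cases "\<exists>q<k. a q < b q")
    case False
    then have ge: "b i \<le> a i" if "i < k" for i
      using False that by (meson not_less)
    have "(\<Sum>i<k. a i - b i) = 0" using total by (simp add: sum_subtractf)
    then have "\<forall>i\<in>{..<k}. a i - b i = 0"
      using ge by (subst (asm) sum_nonneg_eq_0_iff) auto
    then show ?thesis using ext[of a b] by auto
  next
    case True
    define q where "q = (LEAST q. q < k \<and> a q < b q)"
    have "q < k \<and> a q < b q"
      unfolding q_def by (rule LeastI_ex) (use True in auto)
    then have q: "q < k" "a q < b q" by auto
    have least: "b i \<le> a i" if "i < q" "i < k" for i
      using not_less_Least[of i "\<lambda>q. q < k \<and> a q < b q"] that by (auto simp: q_def not_less)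
    \<comment> \<open>Otherwise the first \<open>q + 1\<close> entries of \<open>a\<close> would sum
      to less than those of \<open>b\<close>.\<close>
    have "\<exists>p<q. b p < a p"
    proof (rule ccontr)
      assume "\<not> ?thesis"
      then have "(\<Sum>i<q. a i) \<le> (\<Sum>i<q. b i)"
        by (intro sum_mono) (meson lessThan_iff not_less)
      then have "(\<Sum>i<Suc q. a i) < (\<Sum>i<Suc q. b i)" using q by simp
      then show False using sums[of "Suc q"] q by simp
    qed
    define p where "p = Max {p. p < q \<and> b p < a p}"
    have "p \<in> {p. p < q \<and> b p < a p}"
      unfolding p_def by (rule Max_in) (use \<open>\<exists>p<q. b p < a p\<close> in auto)
    then have p: "p < q" "b p < a p" by auto
    have "i \<le> p" if "i < q" "b i < a i" for i
      unfolding p_def using that by (intro Max_ge) auto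
    then have between: "a i = b i" if "p < i" "i < q" for i
      using that least[of i] q by force
    \<comment> \<open>The largest amount that overshoots \<open>b\<close> at neither place; it
      produces equality at \<open>p\<close> or at \<open>q\<close>.\<close>
    define d where "d = min (a p - b p) (b q - a q)"
    have d: "0 < d" "d \<le> a p - b p" "d \<le> b q - a q" using p q by (auto simp: d_def)
    define a' where "a' = a(p := a p - d, q := a q + d)"
    have a'p: "a' p = a p - d" "a' q = a q + d" "\<And>i. i \<noteq> p \<Longrightarrow> i \<noteq> q \<Longrightarrow> a' i = a i"
      using p by (auto simp: a'_def)
    have pk: "p < k" using p q by simp
    have bpq: "b q \<le> b p" using b[of p q] p q by simp
    have "G a \<le> G a'"
      unfolding a'_def using a0 pk q p d bpq b0[OF pk] by (intro transfer) auto
    also have "G a' \<le> G b"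
    proof (rule less.hyps)
      have "a' p = b p \<or> a' q = b q" using a'p by (auto simp: d_def min_def)
      then have "{i. i < k \<and> a' i \<noteq> b i} \<noteq> {i. i < k \<and> a i \<noteq> b i}" using p q pk by force
      moreover have "{i. i < k \<and> a' i \<noteq> b i} \<subseteq> {i. i < k \<and> a i \<noteq> b i}"
        using a'p p q by (auto, metis less_irrefl)
      ultimately show "card {i. i < k \<and> a' i \<noteq> b i} < card {i. i < k \<and> a i \<noteq> b i}"
        by (intro psubset_card_mono) auto
      show "0 \<le> a' i" if "i < k" for i
        using that a0[OF that] d b0[OF pk] a'p by (cases "i = p"; cases "i = q") auto
      show "a' j \<le> a' i" if ij: "i \<le> j" "j < k" for i j
      proof -
        consider "j = p" | "j = q" | "j \<noteq> p" "j \<noteq> q" by auto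
        then show ?thesis
        proof cases
          case 1
          then show ?thesis using ij a[OF ij] a'p d p by (cases "i = p") auto
        next
          case 2
          consider "i = q" | "i = p" | "p < i" "i < q" | "i < p" using ij 2 by linarith
          then show ?thesis
          proof cases
            case 3
            then show ?thesis using 2 d b[of i q] between[of i] q a'p by auto
          next
            case 4
            then show ?thesis using 2 d bpq p a[of i p] pk a'p by auto
          qed (use 2 a'p d bpq in auto)
        next
          case 3
          consider "i = p" "j < q" | "i = p" "q < j" | "i = q" | "i \<noteq> p" "i \<noteq> q" using 3 by linarith
          then show ?thesis
          proof cases
            case 1
            then show ?thesis using 3 ij d b[of p j] between[of j] a'p by auto
          next
            case 2
            then show ?thesis using 3 ij d bpq q a[of q j] a'p by auto
          next
            case 3
            then show ?thesis using \<open>j \<noteq> p\<close> \<open>j \<noteq> q\<close> ij d a[OF ij] a'p by auto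
          next
            case 4
            then show ?thesis using 3 a[OF ij] a'p by auto
          qed
        qed
      qed
      have sum': "(\<Sum>i<r. a' i) = (\<Sum>i<r. a i)" if "q < r" for r
      proof -
        have "(\<Sum>i<r. a' i) = a' p + (a' q + (\<Sum>i\<in>{..<r} - {p} - {q}. a' i))"
          using that p by (simp add: sum.remove[of _ p] sum.remove[of _ q])
        also have "\<dots> = a p + (a q + (\<Sum>i\<in>{..<r} - {p} - {q}. a i))"
          using a'p by simp
        also have "\<dots> = (\<Sum>i<r. a i)"
          using that p by (simp add: sum.remove[of _ p] sum.remove[of _ q])
        finally show ?thesis .
      qed
      show "(\<Sum>i<r. b i) \<le> (\<Sum>i<r. a' i)" if "r \<le> k" for r
      proof (cases "q < r")
        case True
        then show ?thesis using sums[OF that] by (simp add: sum')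
      next
        case False
        have "b i \<le> a' i" if "i < q" for i
          using that least[of i] a'p d q by (cases "i = p") auto
        then show ?thesis using False by (intro sum_mono) auto
      qed
      show "(\<Sum>i<k. b i) = (\<Sum>i<k. a' i)" using total sum'[OF q(1)] by simp
    qed
    finally show ?thesis .
  qed
qed

section \<open>From vectors to sorted sequences\<close>

lemma length_decreasing_list [simp]: "length (decreasing_list (a :: real ^ 'n)) = CARD('n)"
  by (simp add: decreasing_list_def flip: size_mset)

lemma decreasing_list_antimono:
  "i \<le> j \<Longrightarrow> j < CARD('n) \<Longrightarrow> decreasing_list (a :: real ^ 'n) ! j \<le> decreasing_list a ! i"
  using sorted_rev_nth_mono[of "decreasing_list a" i j] length_decreasing_list[of a]
  by (simp add: decreasing_list_def)

text \<open>The numbering \<open>h\<close> links list positions to vector indices. Reading the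
  vector along \<open>h\<close> gives a list with the same multiset of entries, hence a
  rearrangement of the sorted one.\<close>

lemma decreasing_list_enum:
  fixes a :: "real ^ 'n" and h :: "'n \<Rightarrow> nat"
  assumes h: "bij_betw h UNIV {..<CARD('n)}"
  obtains \<pi> where "\<pi> permutes UNIV" "\<And>x. decreasing_list a ! h x = a $ \<pi> x"
proof -
  define g where "g = inv_into UNIV h"
  have g: "bij_betw g {..<CARD('n)} UNIV" unfolding g_def by (rule bij_betw_inv_into[OF h])
  define ys where "ys = map (\<lambda>i. a $ g i) [0..<CARD('n)]"
  have "mset ys = image_mset (($) a) (image_mset g (mset_set {..<CARD('n)}))"
    by (simp add: ys_def image_mset.compositionality comp_def lessThan_atLeast0)
  also have "image_mset g (mset_set {..<CARD('n)}) = mset_set UNIV"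
    using g by (subst image_mset_mset_set) (auto simp: bij_betw_def)
  finally have "mset (decreasing_list a) = mset ys"
    by (simp add: decreasing_list_def)
  then obtain p where p: "p permutes {..<length ys}" "permute_list p ys = decreasing_list a"
    by (rule mset_eq_permutation)
  have hx: "h x < CARD('n)" for x using h by (auto simp: bij_betw_def)
  have pb: "bij_betw p {..<CARD('n)} {..<CARD('n)}"
    using p(1) permutes_imp_bij by (fastforce simp: ys_def)
  define \<pi> where "\<pi> x = g (p (h x))" for x
  have "bij_betw (g \<circ> (p \<circ> h)) UNIV UNIV"
    by (intro bij_betw_trans[OF bij_betw_trans[OF h pb] g])
  then have "bij \<pi>"
    by (simp add: \<pi>_def[abs_def] comp_def)
  then have "\<pi> permutes UNIV"
    by (intro bij_imp_permutes) auto
  moreover have "decreasing_list a ! h x = a $ \<pi> x" for x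
  proof -
    have "p (h x) < CARD('n)" using pb hx by (auto simp: bij_betw_def)
    then show ?thesis
      using p hx[of x] by (simp flip: p(2) add: permute_list_nth ys_def \<pi>_def)
  qed
  ultimately show ?thesis by (rule that)
qed

lemma pair_transfer_swap:
  assumes "i \<noteq> j"
  shows "pair_transfer i j u (\<chi> l. u $ Transposition.transpose i j l)"
    and "pair_transfer i j (\<chi> l. u $ Transposition.transpose i j l) u"
  using assms by (auto simp: pair_transfer_def transpose_def mult.commute abs_mult)

text \<open>A transposition of coordinates is a transfer in both directions, so it leaves
  \<open>F\<close> unchanged; transpositions generate all permutations.\<close>

lemma permutation_invariant:
  fixes F :: "real ^ 'n \<Rightarrow> real"
  assumes F: "\<And>i j t s. pair_transfer i j t s \<Longrightarrow> F t \<le> F s" and "\<pi> permutes UNIV"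
  shows "F (\<chi> l. u $ \<pi> l) = F u"
  using assms(2) finite
proof (induction arbitrary: u rule: permutes_induct)
  case id
  then show ?case by simp
next
  case (swap i j p)
  have "F (\<chi> l. u $ (Transposition.transpose i j \<circ> p) l) = F (\<chi> l. (\<chi> l. u $ Transposition.transpose i j l) $ p l)"
    by simp
  also have "\<dots> = F (\<chi> l. u $ Transposition.transpose i j l)" by (rule swap.IH)
  also have "\<dots> = F u"
    using pair_transfer_swap[OF \<open>i \<noteq> j\<close>, of u] by (intro antisym F)
  finally show ?case .
qed

lemma sum_nth_eq_sum_list_take:
  fixes L :: "real list"
  shows "r \<le> length L \<Longrightarrow> (\<Sum>i<r. L ! i) = sum_list (take r L)"
  by (simp add: sum_list_sum_nth min_def lessThan_atLeast0)

lemma set_decreasing_list: "set (decreasing_list a) = range (($) a)"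
  by (simp add: decreasing_list_def)

lemma sum_list_decreasing_list: "sum_list (decreasing_list a) = (\<Sum>l\<in>UNIV. a $ l)"
  by (simp add: decreasing_list_def sum_unfold_sum_mset flip: sum_mset_sum_list)

lemma decreasing_list_nth_nonneg:
  assumes "\<And>l. 0 \<le> a $ l" "i < CARD('n)"
  shows "0 \<le> decreasing_list (a :: real ^ 'n) ! i"
proof -
  have "decreasing_list a ! i \<in> set (decreasing_list a)"
    using assms(2) by (intro nth_mem) simp
  then show ?thesis using assms(1) by (auto simp: set_decreasing_list)
qed

lemma majorizes_transfer_mono:
  fixes F :: "real ^ 'n \<Rightarrow> real"
  assumes F: "\<And>i j t s. pair_transfer i j t s \<Longrightarrow> F t \<le> F s"
    and abs: "\<And>t s. (\<And>l. \<bar>t $ l\<bar> = \<bar>s $ l\<bar>) \<Longrightarrow> F t = F s"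
    and maj: "majorizes (sq_vec v) (sq_vec u)"
  shows "F v \<le> F u"
proof -
  let ?k = "CARD('n)"
  obtain h :: "'n \<Rightarrow> nat" where h: "bij_betw h UNIV {..<?k}"
    using ex_bij_betw_finite_nat[of "UNIV :: 'n set"] by (auto simp: lessThan_atLeast0)
  \<comment> \<open>The sequence holds squared coordinates. Square roots recover the vector up to
    signs, to which \<open>F\<close> is insensitive by \<open>abs\<close>, and up to a permutation,
    handled in \<open>Geq\<close>.\<close>
  define G where "G a = F (\<chi> l. sqrt (a (h l)))" for a
  have hk: "h l < ?k" for l using h by (auto simp: bij_betw_def)
  have Geq: "G (\<lambda>i. decreasing_list (sq_vec w) ! i) = F w" for w
  proof -
    obtain \<pi> where \<pi>: "\<pi> permutes UNIV" "\<And>x. decreasing_list (sq_vec w) ! h x = sq_vec w $ \<pi> x"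
      using decreasing_list_enum[OF h] by blast
    have "G (\<lambda>i. decreasing_list (sq_vec w) ! i) = F (\<chi> l. (\<chi> l. \<bar>w $ l\<bar>) $ \<pi> l)"
      by (simp add: G_def \<pi>(2)) (simp add: sq_vec_def)
    also have "\<dots> = F (\<chi> l. \<bar>w $ l\<bar>)" by (rule permutation_invariant[OF F \<pi>(1)])
    also have "\<dots> = F w" by (rule abs) simp
    finally show ?thesis .
  qed
  have "G (\<lambda>i. decreasing_list (sq_vec v) ! i) \<le> G (\<lambda>i. decreasing_list (sq_vec u) ! i)"
  proof (rule transfer_chain[where k = ?k and G = G and a = "\<lambda>i. decreasing_list (sq_vec v) ! i"
        and b = "\<lambda>i. decreasing_list (sq_vec u) ! i"])
    show "G a = G b" if "\<And>i. i < ?k \<Longrightarrow> a i = b i" for a b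
      using that hk by (simp add: G_def)
    show "G a \<le> G (a(p := a p - d, q := a q + d))"
      if pq: "p < ?k" "q < ?k" "p \<noteq> q" and a0: "\<And>i. i < ?k \<Longrightarrow> 0 \<le> a i" and d: "0 \<le> a p - d" "0 \<le> d" "d \<le> a p - a q"
      for a p q d
    proof -
      obtain i j where ij: "h i = p" "h j = q" using h pq unfolding bij_betw_def by (metis imageE lessThan_iff)
      have inj: "h l = h m \<longleftrightarrow> l = m" for l m using h by (auto simp: bij_betw_def inj_on_def)
      have "0 \<le> a p" "0 \<le> a q" using a0 pq by auto
      \<comment> \<open>The product gains exactly \<open>d * (a p - a q - d)\<close>.\<close>
      moreover have "a p * a q \<le> (a p - d) * (a q + d)"
        using mult_nonneg_nonneg[of d "a p - a q - d"] d by (simp add: algebra_simps)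
      ultimately show ?thesis
        unfolding G_def using ij pq d
        by (intro F[of i j]) (auto simp: pair_transfer_def inj real_sqrt_mult[symmetric] abs_mult[symmetric])
    qed
    show "(\<Sum>i<r. decreasing_list (sq_vec u) ! i) \<le> (\<Sum>i<r. decreasing_list (sq_vec v) ! i)" if "r \<le> ?k" for r
      using maj that by (cases "r = 0") (auto simp: sum_nth_eq_sum_list_take majorizes_def)
    show "(\<Sum>i<?k. decreasing_list (sq_vec u) ! i) = (\<Sum>i<?k. decreasing_list (sq_vec v) ! i)"
      using maj by (simp add: sum_nth_eq_sum_list_take sum_list_decreasing_list majorizes_def)
  qed (auto simp: sq_vec_def intro: decreasing_list_nth_nonneg decreasing_list_antimono)
  then show ?thesis by (simp add: Geq)
qed

text \<open>If the \<open>j\<close> largest entries summed to less than \<open>j * c\<close>, one of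
  them would be below \<open>c\<close>, hence so would all later ones, and the total would be too
  small.\<close>

lemma majorizes_constant:
  fixes a :: "real ^ 'n"
  assumes "(\<Sum>l\<in>UNIV. a $ l) = real CARD('n) * c"
  shows "majorizes a (\<chi> l. c)"
proof -
  let ?L = "decreasing_list a" and ?k = "CARD('n)"
  have const: "decreasing_list ((\<chi> l. c) :: real ^ 'n) = replicate ?k c"
    by (rule replicate_eqI) (auto simp: set_decreasing_list)
  have total: "(\<Sum>i<?k. ?L ! i - c) = 0"
    using assms by (simp add: sum_subtractf sum_nth_eq_sum_list_take sum_list_decreasing_list)
  have "real j * c \<le> sum_list (take j ?L)" if "j \<le> ?k" for j
  proof (rule ccontr)
    assume "\<not> ?thesis"
    then have neg: "(\<Sum>i<j. ?L ! i - c) < 0"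
      using that by (simp add: sum_subtractf sum_nth_eq_sum_list_take)
    then obtain m where m: "m < j" "?L ! m < c"
      by (metis diff_ge_0_iff_ge lessThan_iff not_less sum_nonneg)
    have "?L ! i \<le> c" if "i \<in> {j..<?k}" for i
      using decreasing_list_antimono[of m i a] m that by auto
    then have "(\<Sum>i\<in>{j..<?k}. ?L ! i - c) \<le> 0" by (intro sum_nonpos) auto
    moreover have "(\<Sum>i<?k. ?L ! i - c) = (\<Sum>i<j. ?L ! i - c) + (\<Sum>i\<in>{j..<?k}. ?L ! i - c)"
      using that by (simp add: lessThan_atLeast0 sum.atLeastLessThan_concat)
    ultimately show False using neg total by simp
  qed
  then show ?thesis
    using assms by (simp add: majorizes_def const sum_list_replicate min_def)
qed

text \<open>The largest entry of the axis vector already carries the whole total, which bounds every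
  partial sum of a nonnegative vector.\<close>

lemma majorizes_axis:
  fixes a :: "real ^ 'n"
  assumes nonneg: "\<And>l. 0 \<le> a $ l"
  shows "majorizes (axis i (\<Sum>l\<in>UNIV. a $ l)) a"
  unfolding majorizes_def
proof (intro conjI ballI)
  let ?s = "\<Sum>l\<in>UNIV. a $ l"
  let ?b = "axis i ?s :: real ^ 'n"
  show "(\<Sum>l\<in>UNIV. ?b $ l) = ?s"
    by (simp add: axis_def)
  fix j assume j: "j \<in> {1..CARD('n)}"
  have s: "0 \<le> ?s" using nonneg by (rule sum_nonneg)
  have "sum_list (take j (decreasing_list a)) \<le> sum_list (decreasing_list a)"
  proof -
    have "(\<Sum>m<j. decreasing_list a ! m) \<le> (\<Sum>m<CARD('n). decreasing_list a ! m)"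
      using j by (intro sum_mono2) (auto intro: decreasing_list_nth_nonneg nonneg)
    then show ?thesis using j by (simp add: sum_nth_eq_sum_list_take)
  qed
  also have "\<dots> = ?s" by (rule sum_list_decreasing_list)
  also have "?s \<le> decreasing_list ?b ! 0"
  proof -
    have "?s \<in> set (decreasing_list ?b)"
      unfolding set_decreasing_list by (rule image_eqI[of _ _ i]) (simp_all add: axis_def)
    then obtain m where "m < CARD('n)" "decreasing_list ?b ! m = ?s"
      by (auto simp: in_set_conv_nth)
    then show ?thesis using decreasing_list_antimono[of 0 m ?b] by simp
  qed
  also have "\<dots> \<le> (\<Sum>m<j. decreasing_list ?b ! m)"
    using j s by (intro member_le_sum) (auto intro!: decreasing_list_nth_nonneg simp: axis_def)
  also have "\<dots> = sum_list (take j (decreasing_list ?b))"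
    using j by (simp add: sum_nth_eq_sum_list_take)
  finally show "sum_list (take j (decreasing_list a)) \<le> sum_list (take j (decreasing_list ?b))" .
qed

subsection \<open>Asymptotic relative efficiency\<close>

definition pmean_power :: "ereal \<Rightarrow> real \<Rightarrow> real ^ 'n \<Rightarrow> real" where
  "pmean_power p \<alpha> s = mean_functional.test_power (pmean p) (crit_val TYPE('n) p \<alpha>) s"

lemma pmean_power_eq:
  "pmean_power p \<alpha> (s :: real ^ 'n) = measure std_normal_vec {z. pmean p (z + s) > crit_val TYPE('n) p \<alpha>}"
  unfolding pmean_power_def mean_functional.test_power_def[OF mean_functional_pmean] ..

lemma is_shift_iff: "is_shift p \<alpha> \<beta> u s \<longleftrightarrow> (\<exists>t>0. s = t *\<^sub>R u) \<and> pmean_power p \<alpha> s = \<beta>"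
  by (simp add: is_shift_def pmean_power_eq)

lemma
  assumes "0 < \<alpha>" "\<alpha> < 1"
  shows crit_val_pos: "0 < crit_val TYPE('n::finite) p \<alpha>"
    and pmean_power_0: "pmean_power p \<alpha> (0 :: real ^ 'n) = \<alpha>"
proof -
  have "0 < crit_val TYPE('n) p \<alpha> \<and>
      measure (std_normal_vec :: (real ^ 'n) measure) {z. crit_val TYPE('n) p \<alpha> < pmean p z} = \<alpha>"
    unfolding crit_val_def by (rule theI') (rule mean_functional.ex1_crit_val[OF mean_functional_pmean assms])
  then show "0 < crit_val TYPE('n) p \<alpha>" "pmean_power p \<alpha> (0 :: real ^ 'n) = \<alpha>"
    by (simp_all add: pmean_power_eq)
qed

lemma pmean_power_ray_strict_mono:
  assumes "0 < \<alpha>" "\<alpha> < 1" "u \<noteq> 0" "0 \<le> a" "a < b"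
  shows "pmean_power p \<alpha> (a *\<^sub>R u) < pmean_power p \<alpha> (b *\<^sub>R u)"
  unfolding pmean_power_def
  by (rule mean_functional.test_power_ray_strict_mono[OF mean_functional_pmean assms(3-5) crit_val_pos[OF assms(1,2)]])

lemma continuous_on_pmean_power:
  "0 < \<alpha> \<Longrightarrow> \<alpha> < 1 \<Longrightarrow> continuous_on UNIV (pmean_power p \<alpha>)"
  unfolding pmean_power_def[abs_def]
  by (rule mean_functional.continuous_test_power[OF mean_functional_pmean crit_val_pos])

lemma is_shift_unique:
  assumes \<alpha>: "0 < \<alpha>" "\<alpha> < 1" and u: "u \<noteq> 0"
    and "is_shift p \<alpha> \<beta> u s" "is_shift p \<alpha> \<beta> u s'"
  shows "s = s'"
proof -
  obtain t t' where t: "0 < t" "s = t *\<^sub>R u" "0 < t'" "s' = t' *\<^sub>R u"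
    and eq: "pmean_power p \<alpha> (t *\<^sub>R u) = pmean_power p \<alpha> (t' *\<^sub>R u)"
    using assms(4,5) by (auto simp: is_shift_iff)
  then have "t = t'"
    using pmean_power_ray_strict_mono[OF \<alpha> u, of t t' p] pmean_power_ray_strict_mono[OF \<alpha> u, of t' t p]
    by (cases t t' rule: linorder_cases) auto
  then show ?thesis using t by simp
qed

lemma shift_eq:
  assumes "0 < \<alpha>" "\<alpha> < 1" "u \<noteq> 0" "is_shift p \<alpha> \<beta> u s"
  shows "shift p \<alpha> \<beta> u = s"
  unfolding shift_def using assms is_shift_unique by (intro the_equality) blast+

lemma norm_shift_cong:
  fixes u v :: "real ^ 'n"
  assumes \<alpha>: "0 < \<alpha>" "\<alpha> < 1" and nz: "u \<noteq> 0" "v \<noteq> 0" and norm: "norm u = norm v"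
    and power: "\<And>t. pmean_power p \<alpha> (t *\<^sub>R u) = pmean_power p \<alpha> (t *\<^sub>R v)"
  shows "norm (shift p \<alpha> \<beta> u) = norm (shift p \<alpha> \<beta> v)"
proof (cases "\<exists>s. is_shift p \<alpha> \<beta> u s")
  case True
  then obtain t where t: "0 < t" "is_shift p \<alpha> \<beta> u (t *\<^sub>R u)" by (auto simp: is_shift_iff)
  then have "is_shift p \<alpha> \<beta> v (t *\<^sub>R v)" by (auto simp: is_shift_iff power)
  then show ?thesis using t shift_eq[OF \<alpha> nz(1)] shift_eq[OF \<alpha> nz(2)] norm by simp
next
  \<comment> \<open>Without a shift both definite descriptions are taken over the same empty
    predicate, so their unspecified values coincide.\<close>
  case False
  then have "is_shift p \<alpha> \<beta> u = (\<lambda>s. False)" "is_shift p \<alpha> \<beta> v = (\<lambda>s. False)"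
    by (auto simp: is_shift_iff fun_eq_iff power)
  then show ?thesis by (simp add: shift_def)
qed

text \<open>If the level \<open>\<beta>\<close> is attained in direction \<open>v\<close> at
  \<open>t\<close>, the larger power and continuity give a parameter \<open>t' \<le> t\<close> for
  \<open>u\<close>. So the denominator shrinks, while \<open>two\<close> makes the numerators equal.
  If no shift exists for \<open>v\<close>, its efficiency is 0.\<close>

lemma ARE_mono:
  fixes u v :: "real ^ 'n"
  assumes \<alpha>: "0 < \<alpha>" and \<beta>: "\<alpha> < \<beta>" "\<beta> < 1"
    and nz: "u \<noteq> 0" "v \<noteq> 0" and norm: "norm u = norm v"
    and le: "\<And>t. 0 < t \<Longrightarrow> pmean_power p \<alpha> (t *\<^sub>R v) \<le> pmean_power p \<alpha> (t *\<^sub>R u)"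
    and two: "\<And>t. pmean_power 2 \<alpha> (t *\<^sub>R u) = pmean_power 2 \<alpha> (t *\<^sub>R v)"
  shows "ARE p \<alpha> \<beta> v \<le> ARE p \<alpha> \<beta> u"
proof (cases "\<exists>s. is_shift p \<alpha> \<beta> v s")
  case False
  then show ?thesis by (simp add: ARE_def)
next
  case True
  have \<alpha>1: "\<alpha> < 1" using \<beta> by simp
  have zero: "pmean_power p \<alpha> (0 :: real ^ 'n) = \<alpha>" by (rule pmean_power_0[OF \<alpha> \<alpha>1])
  obtain t where t: "0 < t" and shift_v: "is_shift p \<alpha> \<beta> v (t *\<^sub>R v)"
    using True by (auto simp: is_shift_iff)
  have "continuous_on {0..t} (\<lambda>x. pmean_power p \<alpha> (x *\<^sub>R u))"
    by (intro continuous_on_compose2[OF continuous_on_pmean_power[OF \<alpha> \<alpha>1]] continuous_intros) auto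
  moreover have "pmean_power p \<alpha> (0 *\<^sub>R u) \<le> \<beta>"
    using \<beta> by (simp add: zero)
  moreover have "\<beta> \<le> pmean_power p \<alpha> (t *\<^sub>R u)"
    using le[OF t] shift_v by (simp add: is_shift_iff)
  ultimately obtain t' where t': "0 \<le> t'" "t' \<le> t" "pmean_power p \<alpha> (t' *\<^sub>R u) = \<beta>"
    using IVT'[of "\<lambda>x. pmean_power p \<alpha> (x *\<^sub>R u)" 0 \<beta> t] t by auto
  have "t' \<noteq> 0" using t'(3) \<beta> zero by auto
  then have t'0: "0 < t'" using t'(1) by simp
  then have shift_u: "is_shift p \<alpha> \<beta> u (t' *\<^sub>R u)"
    using t'(3) unfolding is_shift_iff by blast
  have "norm (t' *\<^sub>R u) \<le> norm (t *\<^sub>R v)"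
    using t' t norm by (simp add: mult_right_mono)
  then have le2: "(norm (t' *\<^sub>R u))\<^sup>2 \<le> (norm (t *\<^sub>R v))\<^sup>2"
    by (rule power_mono) simp
  have "0 < norm (t *\<^sub>R v)" "0 < norm (t' *\<^sub>R u)" using t'0 t nz by simp_all
  then have "0 < (norm (t *\<^sub>R v))\<^sup>2 * (norm (t' *\<^sub>R u))\<^sup>2"
    by (intro mult_pos_pos zero_less_power)
  then have "(norm (shift 2 \<alpha> \<beta> v))\<^sup>2 / (norm (t *\<^sub>R v))\<^sup>2 \<le> (norm (shift 2 \<alpha> \<beta> v))\<^sup>2 / (norm (t' *\<^sub>R u))\<^sup>2"
    by (rule divide_left_mono[OF le2 zero_le_power2])
  then show ?thesis
    using True shift_u norm_shift_cong[OF \<alpha> \<alpha>1 nz norm two]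
      shift_eq[OF \<alpha> \<alpha>1 nz(1) shift_u] shift_eq[OF \<alpha> \<alpha>1 nz(2) shift_v]
    by (auto simp: ARE_def)
qed

lemma pair_transfer_scaleR:
  assumes "pair_transfer i j x y"
  shows "pair_transfer i j (t *\<^sub>R x) (t *\<^sub>R y)"
proof -
  have "(t * a)\<^sup>2 + (t * b)\<^sup>2 = t\<^sup>2 * (a\<^sup>2 + b\<^sup>2)" "\<bar>t * a * (t * b)\<bar> = t\<^sup>2 * \<bar>a * b\<bar>" for a b :: real
    by (simp_all add: power2_eq_square abs_mult algebra_simps)
  then show ?thesis
    using assms by (simp add: pair_transfer_def mult_left_mono)
qed

lemma pmean_power_majorizes:
  fixes u v :: "real ^ 'n"
  assumes maj: "majorizes (sq_vec v) (sq_vec u)"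
  shows "p \<le> 2 \<Longrightarrow> pmean_power p \<alpha> (t *\<^sub>R v) \<le> pmean_power p \<alpha> (t *\<^sub>R u)"
    and "2 \<le> p \<Longrightarrow> pmean_power p \<alpha> (t *\<^sub>R u) \<le> pmean_power p \<alpha> (t *\<^sub>R v)"
proof -
  have abs: "pmean_power p \<alpha> (t *\<^sub>R x) = pmean_power p \<alpha> (t *\<^sub>R y)"
    if "\<And>l. \<bar>x $ l\<bar> = \<bar>y $ l\<bar>" for x y :: "real ^ 'n"
    unfolding pmean_power_def
    by (rule mean_functional.test_power_abs_cong[OF mean_functional_pmean]) (simp add: abs_mult that)
  show "pmean_power p \<alpha> (t *\<^sub>R v) \<le> pmean_power p \<alpha> (t *\<^sub>R u)" if p: "p \<le> 2"
  proof (rule majorizes_transfer_mono[where F = "\<lambda>s. pmean_power p \<alpha> (t *\<^sub>R s)", OF _ abs maj])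
    fix i j and x y :: "real ^ 'n"
    assume "pair_transfer i j x y"
    from mean_functional.test_power_pair_transfer[OF mean_functional_pmean
        pmean_pair_transfer_le[OF _ p] pair_transfer_scaleR[OF this]]
    show "pmean_power p \<alpha> (t *\<^sub>R x) \<le> pmean_power p \<alpha> (t *\<^sub>R y)"
      by (simp add: pmean_power_def)
  qed
  show "pmean_power p \<alpha> (t *\<^sub>R u) \<le> pmean_power p \<alpha> (t *\<^sub>R v)" if p: "2 \<le> p"
  proof -
    have "- pmean_power p \<alpha> (t *\<^sub>R v) \<le> - pmean_power p \<alpha> (t *\<^sub>R u)"
    proof (rule majorizes_transfer_mono[where F = "\<lambda>s. - pmean_power p \<alpha> (t *\<^sub>R s)", OF _ _ maj])
      fix i j and x y :: "real ^ 'n"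
      assume "pair_transfer i j x y"
      from mean_functional.test_power_pair_transfer'[OF mean_functional_pmean
          pmean_pair_transfer_ge[OF _ p] pair_transfer_scaleR[OF this]]
      show "- pmean_power p \<alpha> (t *\<^sub>R x) \<le> - pmean_power p \<alpha> (t *\<^sub>R y)"
        by (simp add: pmean_power_def)
    qed (simp, rule abs)
    then show ?thesis by simp
  qed
qed

lemma pmean_2_eq_1_iff: "pmean 2 u = 1 \<longleftrightarrow> (\<Sum>l\<in>UNIV. (u $ l)\<^sup>2) = real CARD('n)" for u :: "real ^ 'n"
proof -
  have "pmean (ereal 2) u = sqrt ((\<Sum>l\<in>UNIV. (u $ l)\<^sup>2) / real CARD('n))"
    by (subst pmean_pos_real) (simp_all add: powr_half_sqrt sum_nonneg abs_powr_eq)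
  then show ?thesis by (auto simp: numeral_eq_ereal)
qed

lemma ARE_majorizes:
  fixes u v :: "real ^ 'n"
  assumes \<alpha>: "0 < \<alpha>" and \<beta>: "\<alpha> < \<beta>" "\<beta> < 1" and uv: "pmean 2 u = 1" "pmean 2 v = 1"
    and maj: "majorizes (sq_vec v) (sq_vec u)"
  shows "p \<le> 2 \<Longrightarrow> ARE p \<alpha> \<beta> v \<le> ARE p \<alpha> \<beta> u" and "2 \<le> p \<Longrightarrow> ARE p \<alpha> \<beta> u \<le> ARE p \<alpha> \<beta> v"
proof -
  have norm: "norm u = norm v"
    using uv unfolding pmean_2_eq_1_iff by (simp add: norm_vec_def L2_set_def)
  have nz: "u \<noteq> 0" "v \<noteq> 0"
    using uv unfolding pmean_2_eq_1_iff by auto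
  \<comment> \<open>The exponent 2 satisfies both \<open>p \<le> 2\<close> and
    \<open>2 \<le> p\<close>, so the two opposite inequalities combine.\<close>
  have two: "pmean_power 2 \<alpha> (t *\<^sub>R u) = pmean_power 2 \<alpha> (t *\<^sub>R v)" for t
    using pmean_power_majorizes[OF maj, of 2] by (intro antisym) auto
  show "ARE p \<alpha> \<beta> v \<le> ARE p \<alpha> \<beta> u" if "p \<le> 2"
    using pmean_power_majorizes(1)[OF maj that] by (intro ARE_mono \<alpha> \<beta> nz norm two)
  show "ARE p \<alpha> \<beta> u \<le> ARE p \<alpha> \<beta> v" if "2 \<le> p"
    using pmean_power_majorizes(2)[OF maj that] by (intro ARE_mono \<alpha> \<beta> nz norm[symmetric] two[symmetric])
qed

text \<open>The index type has no first element, so an arbitrary index \<open>i\<^sub>1\<close>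
  takes that role. The bounds follow since the squares of every admissible vector majorize the
  constant vector 1 and are majorized by the total placed on one axis.\<close>

theorem corollary2p12:
  fixes \<alpha> \<beta> :: real and i\<^sub>1 :: "'n::finite"
  assumes "0 < \<alpha>" and "\<alpha> < \<beta>" and "\<beta> < 1"
  shows "(\<forall>p::ereal. 2 \<le> p \<longrightarrow>
            schur_sq_convex_on {u :: real ^ 'n. pmean 2 u = 1} (ARE p \<alpha> \<beta>)) \<and>
         (\<forall>p::ereal. p \<le> 2 \<longrightarrow>
            schur_sq_concave_on {u :: real ^ 'n. pmean 2 u = 1} (ARE p \<alpha> \<beta>)) \<and>
         (\<forall>p::ereal. \<forall>u :: real ^ 'n. pmean 2 u = 1 \<longrightarrow>
            (let a = ARE p \<alpha> \<beta> (vec 1 :: real ^ 'n);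
                 b = ARE p \<alpha> \<beta> (sqrt (real CARD('n)) *\<^sub>R axis i\<^sub>1 1 :: real ^ 'n)
             in min a b \<le> ARE p \<alpha> \<beta> u \<and> ARE p \<alpha> \<beta> u \<le> max a b))"
proof (intro conjI allI impI)
  note mono = ARE_majorizes[OF assms]
  show "schur_sq_convex_on {u :: real ^ 'n. pmean 2 u = 1} (ARE p \<alpha> \<beta>)" if "2 \<le> p" for p
    unfolding schur_sq_convex_on_def using mono(2) that by blast
  show "schur_sq_concave_on {u :: real ^ 'n. pmean 2 u = 1} (ARE p \<alpha> \<beta>)" if "p \<le> 2" for p
    unfolding schur_sq_concave_on_def using mono(1) that by blast
  fix p :: ereal and u :: "real ^ 'n"
  assume u: "pmean 2 u = 1"
  let ?e = "sqrt (real CARD('n)) *\<^sub>R axis i\<^sub>1 1 :: real ^ 'n"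
  have sum: "(\<Sum>l\<in>UNIV. sq_vec u $ l) = real CARD('n)"
    using u unfolding pmean_2_eq_1_iff by (simp add: sq_vec_def)
  have "sq_vec (vec 1 :: real ^ 'n) = (\<chi> l. 1)"
    by (simp add: sq_vec_def vec_eq_iff)
  then have maj1: "majorizes (sq_vec u) (sq_vec (vec 1))"
    using majorizes_constant[of "sq_vec u" 1] sum by simp
  have "sq_vec ?e = axis i\<^sub>1 (real CARD('n))"
    by (simp add: sq_vec_def vec_eq_iff axis_def power_mult_distrib)
  then have maj2: "majorizes (sq_vec ?e) (sq_vec u)"
    using majorizes_axis[of "sq_vec u" i\<^sub>1] sum by (simp add: sq_vec_def)
  have one: "pmean 2 (vec 1 :: real ^ 'n) = 1" by simp
  have e: "pmean 2 ?e = 1"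
    unfolding pmean_2_eq_1_iff
    by (simp add: axis_def power_mult_distrib if_distrib[of "\<lambda>x. x\<^sup>2"]
        cong: if_cong flip: sum_distrib_left)
  note bounds = mono[OF one u maj1, of p] mono[OF u e maj2, of p]
  show "let a = ARE p \<alpha> \<beta> (vec 1 :: real ^ 'n); b = ARE p \<alpha> \<beta> ?e
      in min a b \<le> ARE p \<alpha> \<beta> u \<and> ARE p \<alpha> \<beta> u \<le> max a b"
    using bounds by (cases "p \<le> 2") (simp_all add: Let_def min_le_iff_disj le_max_iff_disj)
qed

end
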